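(* Let $\varphi:(M^m,g_M)\rightarrow N^n(c)$ be an isometric immersion of a Riemannian manifold into a Riemannian space form of constant curvature $c\in\mathbb{R}$. Then $\varphi$ is a Chern--Federer map if and only if $$\mathrm{CF}(\varphi)=-d\varphi\big(\mathrm{tr}_{g_M}(\nabla Q)\big)+2cm(m-1)\mathcal{H}-\mathrm{tr}_{g_M}h(Q(\cdot),\cdot)=0,$$ equivalently, $$(\top):\ \mathrm{tr}_{g_M}(\nabla Q)=0,\qquad(\bot):\ 2cm(m-1)\mathcal{H}-\mathrm{tr}_{g_M}h(Q(\cdot),\cdot)=0,$$ where $(\top)$ and $(\bot)$ denote the tangent component and the normal component of the first equation, respectively.
   Context: $N^n(c)$ is an $n$-dimensional Riemannian manifold of constant sectional curvature $c$. $h=\widetilde{\nabla}d\varphi$ is the second fundamental form, $\mathcal{H}=\frac1m\mathrm{tr}_{g_M}h$ the mean curvature vector field, $Q$ the Ricci operator of $(M,g_M)$, i.e. $Q(X)=\sum_jR^M(X,e_j)e_j$. For a local orthonormal frame $\{e_i\}$ of $M$, $\mathrm{tr}_{g_M}(\nabla Q)=\sum_i(\nabla_{e_i}Q)(e_i)$ and $\mathrm{tr}_{g_M}h(Q(\cdot),\cdot)=\sum_ih(Q(e_i),e_i)$. Curvature convention: $R(X,Y)=\nabla_X\nabla_Y-\nabla_Y\nabla_X-\nabla_{[X,Y]}$. Definition of Chern--Federer map: with $\overline{\nabla}$ the pull-back connection on $\varphi^{-1}TN$, put $(\widetilde{\nabla}d\varphi)(X,Y)=\overline{\nabla}_X(d\varphi(Y))-d\varphi(\nabla_XY)$,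 and let $\widetilde{\nabla}^2d\varphi$, $\widetilde{\nabla}^3d\varphi$ be its iterated covariant derivatives, the newest differentiation variable placed first: $(\widetilde{\nabla}^2d\varphi)(X,Y,Z)=\overline{\nabla}_X((\widetilde{\nabla}d\varphi)(Y,Z))-(\widetilde{\nabla}d\varphi)(\nabla_XY,Z)-(\widetilde{\nabla}d\varphi)(Y,\nabla_XZ)$, and analogously $\widetilde{\nabla}^3d\varphi(X,Y,Z,W)$ is the covariant derivative of $\widetilde{\nabla}^2d\varphi$ in direction $X$ evaluated at $(Y,Z,W)$. Set $W_1(\varphi)=\sum_{i,j}\{(\widetilde{\nabla}^3d\varphi)(e_i,e_j,e_i,e_j)+R^N((\widetilde{\nabla}d\varphi)(e_i,e_j),d\varphi(e_i))d\varphi(e_j)\}$, $W_2(\varphi)=\sum_{i,j}\{(\widetilde{\nabla}^3d\varphi)(e_i,e_i,e_j,e_j)+R^N((\widetilde{\nabla}d\varphi)(e_i,e_i),d\varphi(e_j))d\varphi(e_j)\}$. Then $\mathrm{CF}(\varphi):=W_2(\varphi)-W_1(\varphi)$, and $\varphi$ is a Chern--Federer map if $\mathrm{CF}(\varphi)=0$. *)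

theory Defs
  imports "HOL-Analysis.Analysis"
begin

section \<open>Smooth maps between Euclidean spaces\<close>

text \<open>The intended sets are open, so that differentiability within the set and
  the derivative at a point agree.\<close>

primrec Ck_on :: "nat \<Rightarrow> 'a::euclidean_space set \<Rightarrow> ('a \<Rightarrow> 'b::real_normed_vector) \<Rightarrow> bool" where
  "Ck_on 0 S f \<longleftrightarrow> continuous_on S f"
| "Ck_on (Suc k) S f \<longleftrightarrow>
     f differentiable_on S \<and> (\<forall>v. Ck_on k S (\<lambda>x. frechet_derivative f (at x) v))"

definition smooth_on :: "'a::euclidean_space set \<Rightarrow> ('a \<Rightarrow> 'b::real_normed_vector) \<Rightarrow> bool" where
  "smooth_on S f \<longleftrightarrow> (\<forall>k. Ck_on k S f)"


section \<open>Manifolds and smooth maps\<close>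

text \<open>A chart is its domain together with its coordinate map. The manifold given by an
  atlas is the union of the chart domains; its dimension is the cardinality of the index type.\<close>

type_synonym ('a, 'm) chart = "'a set \<times> ('a \<Rightarrow> real ^ 'm)"

definition chart_inv :: "('a, 'm::finite) chart \<Rightarrow> real ^ 'm \<Rightarrow> 'a" where
  "chart_inv c = inv_into (fst c) (snd c)"

definition chart_image :: "('a, 'm::finite) chart \<Rightarrow> (real ^ 'm) set" where
  "chart_image c = snd c ` fst c"

definition manifold_carrier :: "('a, 'm::finite) chart set \<Rightarrow> 'a set" where
  "manifold_carrier A = (\<Union>c\<in>A. fst c)"

definition coord_rep ::
  "('a, 'm::finite) chart \<Rightarrow> ('b, 'n::finite) chart \<Rightarrow> ('a \<Rightarrow> 'b) \<Rightarrow> real ^ 'm \<Rightarrow> real ^ 'n" where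
  "coord_rep c d \<phi> = snd d \<circ> \<phi> \<circ> chart_inv c"

definition smooth_atlas ::
  "('a::{t2_space,second_countable_topology}, 'm::finite) chart set \<Rightarrow> bool" where
  "smooth_atlas A \<longleftrightarrow>
     (\<forall>c\<in>A. open (fst c) \<and> open (chart_image c) \<and>
            homeomorphism (fst c) (chart_image c) (snd c) (chart_inv c)) \<and>
     (\<forall>c\<in>A. \<forall>d\<in>A. smooth_on (snd c ` (fst c \<inter> fst d)) (coord_rep c d (\<lambda>p. p)))"

definition smooth_map ::
  "('a::{t2_space,second_countable_topology}, 'm::finite) chart set \<Rightarrow>
   ('b::{t2_space,second_countable_topology}, 'n::finite) chart set \<Rightarrow> ('a \<Rightarrow> 'b) \<Rightarrow> bool" where
  "smooth_map A B \<phi> \<longleftrightarrow>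
     \<phi> ` manifold_carrier A \<subseteq> manifold_carrier B \<and>
     continuous_on (manifold_carrier A) \<phi> \<and>
     (\<forall>c\<in>A. \<forall>d\<in>B. smooth_on (snd c ` (fst c \<inter> \<phi> -` fst d)) (coord_rep c d \<phi>))"


section \<open>Riemannian metrics\<close>

text \<open>Tangent vectors are represented by their components in a chart. A metric on a
  coordinate domain assigns a bilinear form to each coordinate point; a metric on the manifold
  is a family of such, indexed by the charts and transforming as a covariant 2-tensor.\<close>

type_synonym 'm local_metric = "real ^ 'm \<Rightarrow> real ^ 'm \<Rightarrow> real ^ 'm \<Rightarrow> real"

definition local_riemannian_metric :: "(real ^ 'm::finite) set \<Rightarrow> 'm local_metric \<Rightarrow> bool" where
  "local_riemannian_metric S G \<longleftrightarrow>
     (\<forall>x\<in>S. bilinear (G x) \<and> (\<forall>u v. G x u v = G x v u) \<and> (\<forall>u. u \<noteq> 0 \<longrightarrow> G x u u > 0)) \<and>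
     (\<forall>u v. smooth_on S (\<lambda>x. G x u v))"

definition riemannian_metric ::
  "('a, 'm::finite) chart set \<Rightarrow> (('a, 'm) chart \<Rightarrow> 'm local_metric) \<Rightarrow> bool" where
  "riemannian_metric A g \<longleftrightarrow>
     (\<forall>c\<in>A. local_riemannian_metric (chart_image c) (g c)) \<and>
     (\<forall>c\<in>A. \<forall>d\<in>A. \<forall>p\<in>fst c \<inter> fst d. \<forall>u v.
        g c (snd c p) u v =
        g d (snd d p)
          (frechet_derivative (coord_rep c d (\<lambda>q. q)) (at (snd c p)) u)
          (frechet_derivative (coord_rep c d (\<lambda>q. q)) (at (snd c p)) v))"

definition riemannian_manifold ::
  "('a::{t2_space,second_countable_topology}, 'm::finite) chart set \<Rightarrow>
   (('a, 'm) chart \<Rightarrow> 'm local_metric) \<Rightarrow> bool" where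
  "riemannian_manifold A g \<longleftrightarrow> smooth_atlas A \<and> riemannian_metric A g"

definition isometric_immersion ::
  "('a::{t2_space,second_countable_topology}, 'm::finite) chart set \<Rightarrow>
   (('a, 'm) chart \<Rightarrow> 'm local_metric) \<Rightarrow>
   ('b::{t2_space,second_countable_topology}, 'n::finite) chart set \<Rightarrow>
   (('b, 'n) chart \<Rightarrow> 'n local_metric) \<Rightarrow> ('a \<Rightarrow> 'b) \<Rightarrow> bool" where
  "isometric_immersion A g B h \<phi> \<longleftrightarrow>
     smooth_map A B \<phi> \<and>
     (\<forall>c\<in>A. \<forall>d\<in>B. \<forall>p\<in>fst c \<inter> \<phi> -` fst d.
        inj (frechet_derivative (coord_rep c d \<phi>) (at (snd c p))) \<and>
        (\<forall>u v. h d (snd d (\<phi> p))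
                 (frechet_derivative (coord_rep c d \<phi>) (at (snd c p)) u)
                 (frechet_derivative (coord_rep c d \<phi>) (at (snd c p)) v) =
               g c (snd c p) u v))"


section \<open>Levi-Civita connection and curvature in a chart\<close>

text \<open>Vector fields on a coordinate domain are total functions; on an open set all operators
  below depend only on the values of their arguments on that set.\<close>

type_synonym 'm vfield = "real ^ 'm \<Rightarrow> real ^ 'm"

definition gram_matrix :: "'m::finite local_metric \<Rightarrow> real ^ 'm \<Rightarrow> real ^ 'm ^ 'm" where
  "gram_matrix G x = (\<chi> i j. G x (axis i 1) (axis j 1))"

text \<open>\<open>metric_partial G x i j l\<close> is the \<open>i\<close>-th partial derivative of the component \<open>(j, l)\<close>;
  the upper index of the Christoffel symbol is the first one.\<close>

definition metric_partial :: "'m::finite local_metric \<Rightarrow> real ^ 'm \<Rightarrow> 'm \<Rightarrow> 'm \<Rightarrow> 'm \<Rightarrow> real" where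
  "metric_partial G x i j l = frechet_derivative (\<lambda>y. gram_matrix G y $ j $ l) (at x) (axis i 1)"

definition christoffel :: "'m::finite local_metric \<Rightarrow> real ^ 'm \<Rightarrow> 'm \<Rightarrow> 'm \<Rightarrow> 'm \<Rightarrow> real" where
  "christoffel G x k i j =
     (\<Sum>l\<in>UNIV. matrix_inv (gram_matrix G x) $ k $ l *
        (metric_partial G x i j l + metric_partial G x j i l - metric_partial G x l i j)) / 2"

definition christoffel_form ::
  "'m::finite local_metric \<Rightarrow> real ^ 'm \<Rightarrow> real ^ 'm \<Rightarrow> real ^ 'm \<Rightarrow> real ^ 'm" where
  "christoffel_form G x u v = (\<chi> k. \<Sum>i\<in>UNIV. \<Sum>j\<in>UNIV. christoffel G x k i j * u $ i * v $ j)"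

definition levi_civita ::
  "'m::finite local_metric \<Rightarrow> 'm vfield \<Rightarrow> 'm vfield \<Rightarrow> 'm vfield" where
  "levi_civita G X Y = (\<lambda>x. frechet_derivative Y (at x) (X x) + christoffel_form G x (X x) (Y x))"

definition lie_bracket :: "'m::finite vfield \<Rightarrow> 'm vfield \<Rightarrow> 'm vfield" where
  "lie_bracket X Y = (\<lambda>x. frechet_derivative Y (at x) (X x) - frechet_derivative X (at x) (Y x))"

definition curvature ::
  "'m::finite local_metric \<Rightarrow> 'm vfield \<Rightarrow> 'm vfield \<Rightarrow> 'm vfield \<Rightarrow> 'm vfield" where
  "curvature G X Y Z =
     (\<lambda>x. levi_civita G X (levi_civita G Y Z) x - levi_civita G Y (levi_civita G X Z) x
          - levi_civita G (lie_bracket X Y) Z x)"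

text \<open>The curvature tensor on single tangent vectors: by tensoriality any extension to
  vector fields gives the same value, and the one with constant components is used. This is
  needed to apply the curvature of the target to vector fields along a map.\<close>

definition curvature_at ::
  "'m::finite local_metric \<Rightarrow> real ^ 'm \<Rightarrow> real ^ 'm \<Rightarrow> real ^ 'm \<Rightarrow> real ^ 'm \<Rightarrow> real ^ 'm" where
  "curvature_at G x u v w = curvature G (\<lambda>_. u) (\<lambda>_. v) (\<lambda>_. w) x"

definition sectional_curvature ::
  "'m::finite local_metric \<Rightarrow> real ^ 'm \<Rightarrow> real ^ 'm \<Rightarrow> real ^ 'm \<Rightarrow> real" where
  "sectional_curvature G x u v =
     G x (curvature_at G x u v v) u / (G x u u * G x v v - (G x u v)\<^sup>2)"

definition constant_sectional_curvature ::
  "('a, 'm::finite) chart set \<Rightarrow> (('a, 'm) chart \<Rightarrow> 'm local_metric) \<Rightarrow> real \<Rightarrow> bool" where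
  "constant_sectional_curvature A g \<kappa> \<longleftrightarrow>
     (\<forall>c\<in>A. \<forall>x\<in>chart_image c. \<forall>u v.
        u \<noteq> v \<and> independent {u, v} \<longrightarrow> sectional_curvature (g c) x u v = \<kappa>)"


section \<open>Local orthonormal frames and the Ricci operator\<close>

definition orthonormal_frame_on ::
  "(real ^ 'm::finite) set \<Rightarrow> 'm local_metric \<Rightarrow> ('m \<Rightarrow> 'm vfield) \<Rightarrow> bool" where
  "orthonormal_frame_on V G e \<longleftrightarrow>
     (\<forall>i. smooth_on V (e i)) \<and>
     (\<forall>x\<in>V. \<forall>i j. G x (e i x) (e j x) = (if i = j then 1 else 0))"

definition ricci_op :: "'m::finite local_metric \<Rightarrow> ('m \<Rightarrow> 'm vfield) \<Rightarrow> 'm vfield \<Rightarrow> 'm vfield" where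
  "ricci_op G e X = (\<lambda>x. \<Sum>j\<in>UNIV. curvature_at G x (X x) (e j x) (e j x))"

definition nabla_ricci ::
  "'m::finite local_metric \<Rightarrow> ('m \<Rightarrow> 'm vfield) \<Rightarrow> 'm vfield \<Rightarrow> 'm vfield \<Rightarrow> 'm vfield" where
  "nabla_ricci G e X Y =
     (\<lambda>x. levi_civita G X (ricci_op G e Y) x - ricci_op G e (levi_civita G X Y) x)"

definition tr_nabla_ricci :: "'m::finite local_metric \<Rightarrow> ('m \<Rightarrow> 'm vfield) \<Rightarrow> 'm vfield" where
  "tr_nabla_ricci G e = (\<lambda>x. \<Sum>i\<in>UNIV. nabla_ricci G e (e i) (e i) x)"


section \<open>Iterated covariant derivatives of the differential of a map\<close>

text \<open>Here \<open>G\<close> and \<open>H\<close> are the metrics of source and target in fixed charts and \<open>f\<close> is the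
  coordinate representation of the map. A vector field along the map is given by its components
  in the target chart, as a function of the source coordinates.\<close>

type_synonym ('m, 'n) along = "real ^ 'm \<Rightarrow> real ^ 'n"

definition dmap :: "('m::finite, 'n::finite) along \<Rightarrow> 'm vfield \<Rightarrow> ('m, 'n) along" where
  "dmap f X = (\<lambda>x. frechet_derivative f (at x) (X x))"

definition pullback_conn ::
  "'n::finite local_metric \<Rightarrow> ('m::finite, 'n) along \<Rightarrow> 'm vfield \<Rightarrow> ('m, 'n) along \<Rightarrow> ('m, 'n) along" where
  "pullback_conn H f X V =
     (\<lambda>x. frechet_derivative V (at x) (X x) + christoffel_form H (f x) (dmap f X x) (V x))"

text \<open>\<open>nabla_d\<close> is the second fundamental form of an isometric immersion.\<close>

definition nabla_d ::
  "'m::finite local_metric \<Rightarrow> 'n::finite local_metric \<Rightarrow> ('m, 'n) along \<Rightarrow>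
   'm vfield \<Rightarrow> 'm vfield \<Rightarrow> ('m, 'n) along" where
  "nabla_d G H f X Y = (\<lambda>x. pullback_conn H f X (dmap f Y) x - dmap f (levi_civita G X Y) x)"

definition nabla2_d ::
  "'m::finite local_metric \<Rightarrow> 'n::finite local_metric \<Rightarrow> ('m, 'n) along \<Rightarrow>
   'm vfield \<Rightarrow> 'm vfield \<Rightarrow> 'm vfield \<Rightarrow> ('m, 'n) along" where
  "nabla2_d G H f X Y Z =
     (\<lambda>x. pullback_conn H f X (nabla_d G H f Y Z) x
          - nabla_d G H f (levi_civita G X Y) Z x
          - nabla_d G H f Y (levi_civita G X Z) x)"

definition nabla3_d ::
  "'m::finite local_metric \<Rightarrow> 'n::finite local_metric \<Rightarrow> ('m, 'n) along \<Rightarrow>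
   'm vfield \<Rightarrow> 'm vfield \<Rightarrow> 'm vfield \<Rightarrow> 'm vfield \<Rightarrow> ('m, 'n) along" where
  "nabla3_d G H f X Y Z W =
     (\<lambda>x. pullback_conn H f X (nabla2_d G H f Y Z W) x
          - nabla2_d G H f (levi_civita G X Y) Z W x
          - nabla2_d G H f Y (levi_civita G X Z) W x
          - nabla2_d G H f Y Z (levi_civita G X W) x)"

definition W1 ::
  "'m::finite local_metric \<Rightarrow> 'n::finite local_metric \<Rightarrow> ('m, 'n) along \<Rightarrow>
   ('m \<Rightarrow> 'm vfield) \<Rightarrow> ('m, 'n) along" where
  "W1 G H f e = (\<lambda>x. \<Sum>i\<in>UNIV. \<Sum>j\<in>UNIV.
     nabla3_d G H f (e i) (e j) (e i) (e j) x
     + curvature_at H (f x) (nabla_d G H f (e i) (e j) x) (dmap f (e i) x) (dmap f (e j) x))"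

definition W2 ::
  "'m::finite local_metric \<Rightarrow> 'n::finite local_metric \<Rightarrow> ('m, 'n) along \<Rightarrow>
   ('m \<Rightarrow> 'm vfield) \<Rightarrow> ('m, 'n) along" where
  "W2 G H f e = (\<lambda>x. \<Sum>i\<in>UNIV. \<Sum>j\<in>UNIV.
     nabla3_d G H f (e i) (e i) (e j) (e j) x
     + curvature_at H (f x) (nabla_d G H f (e i) (e i) x) (dmap f (e j) x) (dmap f (e j) x))"

definition CF ::
  "'m::finite local_metric \<Rightarrow> 'n::finite local_metric \<Rightarrow> ('m, 'n) along \<Rightarrow>
   ('m \<Rightarrow> 'm vfield) \<Rightarrow> ('m, 'n) along" where
  "CF G H f e = (\<lambda>x. W2 G H f e x - W1 G H f e x)"

definition mean_curvature ::
  "'m::finite local_metric \<Rightarrow> 'n::finite local_metric \<Rightarrow> ('m, 'n) along \<Rightarrow>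
   ('m \<Rightarrow> 'm vfield) \<Rightarrow> ('m, 'n) along" where
  "mean_curvature G H f e = (\<lambda>x. (1 / real CARD('m)) *\<^sub>R (\<Sum>i\<in>UNIV. nabla_d G H f (e i) (e i) x))"

definition tr_h_ricci ::
  "'m::finite local_metric \<Rightarrow> 'n::finite local_metric \<Rightarrow> ('m, 'n) along \<Rightarrow>
   ('m \<Rightarrow> 'm vfield) \<Rightarrow> ('m, 'n) along" where
  "tr_h_ricci G H f e = (\<lambda>x. \<Sum>i\<in>UNIV. nabla_d G H f (ricci_op G e (e i)) (e i) x)"

text \<open>Orthogonal decomposition of a vector at \<open>f x\<close> with respect to the image of the
  differential of \<open>f\<close> at \<open>x\<close>.\<close>

definition tangent_part ::
  "'n::finite local_metric \<Rightarrow> ('m::finite, 'n) along \<Rightarrow> real ^ 'm \<Rightarrow> real ^ 'n \<Rightarrow> real ^ 'n" where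
  "tangent_part H f x v =
     (THE w. w \<in> range (frechet_derivative f (at x)) \<and>
             (\<forall>u. H (f x) (v - w) (frechet_derivative f (at x) u) = 0))"

definition normal_part ::
  "'n::finite local_metric \<Rightarrow> ('m::finite, 'n) along \<Rightarrow> real ^ 'm \<Rightarrow> real ^ 'n \<Rightarrow> real ^ 'n" where
  "normal_part H f x v = v - tangent_part H f x v"


section \<open>Chern--Federer maps\<close>

text \<open>\<open>local_frame A g c V e\<close>: \<open>e\<close> is a local orthonormal frame over the part of the chart \<open>c\<close>
  with coordinates in \<open>V\<close>.\<close>

definition local_frame ::
  "('a, 'm::finite) chart set \<Rightarrow> (('a, 'm) chart \<Rightarrow> 'm local_metric) \<Rightarrow>
   ('a, 'm) chart \<Rightarrow> (real ^ 'm) set \<Rightarrow> ('m \<Rightarrow> 'm vfield) \<Rightarrow> bool" where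
  "local_frame A g c V e \<longleftrightarrow>
     c \<in> A \<and> open V \<and> V \<subseteq> chart_image c \<and> orthonormal_frame_on V (g c) e"

text \<open>In addition, \<open>\<phi>\<close> maps the domain of the frame into the chart \<open>d\<close> of the target, so that
  vector fields along \<open>\<phi>\<close> have components with respect to \<open>d\<close> there.\<close>

definition local_frame_along ::
  "('a, 'm::finite) chart set \<Rightarrow> (('a, 'm) chart \<Rightarrow> 'm local_metric) \<Rightarrow> ('b, 'n::finite) chart set \<Rightarrow>
   ('a \<Rightarrow> 'b) \<Rightarrow> ('a, 'm) chart \<Rightarrow> ('b, 'n) chart \<Rightarrow> (real ^ 'm) set \<Rightarrow> ('m \<Rightarrow> 'm vfield) \<Rightarrow> bool" where
  "local_frame_along A g B \<phi> c d V e \<longleftrightarrow>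
     local_frame A g c V e \<and> d \<in> B \<and> V \<subseteq> snd c ` (fst c \<inter> \<phi> -` fst d)"

text \<open>\<open>CF(\<phi>)\<close> does not depend on the frame, so it vanishes iff its components vanish for all
  charts and all local orthonormal frames. (Around each point there are such frames, by
  Gram-Schmidt.)\<close>

definition chern_federer_map ::
  "('a::{t2_space,second_countable_topology}, 'm::finite) chart set \<Rightarrow>
   (('a, 'm) chart \<Rightarrow> 'm local_metric) \<Rightarrow>
   ('b::{t2_space,second_countable_topology}, 'n::finite) chart set \<Rightarrow>
   (('b, 'n) chart \<Rightarrow> 'n local_metric) \<Rightarrow> ('a \<Rightarrow> 'b) \<Rightarrow> bool" where
  "chern_federer_map A g B h \<phi> \<longleftrightarrow>
     (\<forall>c d V e. local_frame_along A g B \<phi> c d V e \<longrightarrow>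
        (\<forall>x\<in>V. CF (g c) (h d) (coord_rep c d \<phi>) e x = 0))"

end

theory Submission
  imports Defs
begin

text \<open>Write \<open>h\<close> for the second fundamental form. \<open>W\<^sub>2\<close> and \<open>W\<^sub>1\<close> differ in two ways.

  The third derivatives differ by an exchange of the second and third argument, so their
  difference \<open>\<Sum>\<^sub>i\<^sub>j (\<nabla>\<^sup>3d\<phi>)(e\<^sub>i,e\<^sub>i,e\<^sub>j,e\<^sub>j) - (\<nabla>\<^sup>3d\<phi>)(e\<^sub>i,e\<^sub>j,e\<^sub>i,e\<^sub>j)\<close> is the divergence of the skew part
  \<open>A(Y,Z,W) = (\<nabla>\<^sup>2d\<phi>)(Y,Z,W) - (\<nabla>\<^sup>2d\<phi>)(Z,Y,W)\<close>, traced over \<open>Z = W\<close>. By the Ricci identity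
  \<open>A(Y,Z,W) = R\<^sup>N(d\<phi> Y, d\<phi> Z) d\<phi> W - d\<phi>(R\<^sup>M(Y,Z)W)\<close> (\<open>ricci_identity\<close>), and because the target has
  constant curvature \<open>\<kappa>\<close> and the map is isometric, this is tangential: its trace
  \<open>\<Sum>\<^sub>j A(Y,e\<^sub>j,e\<^sub>j)\<close> is \<open>d\<phi>\<close> of \<open>\<kappa>(m-1)Y - QY\<close>. The covariant derivative of \<open>d\<phi>(\<kappa>(m-1)Id - Q)\<close> has a
  normal part, given by \<open>h\<close>, and a tangential part, given by \<open>\<nabla>Q\<close>; its divergence is
  \<open>\<kappa>m(m-1)\<H> - tr h(Q,\<cdot>) - d\<phi>(tr \<nabla>Q)\<close> (\<open>trace_nabla3_d_difference\<close>). The derivatives of the frame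
  drop out since the connection coefficients of an orthonormal frame are skew
  (\<open>skew_frame_sum\<close>).

  The curvature terms contribute the same multiple of \<open>\<H>\<close> once more: since \<open>h\<close> is normal
  (\<open>II_normal\<close>), they are \<open>\<kappa>m\<^sup>2\<H>\<close> in \<open>W\<^sub>2\<close> and \<open>\<kappa>m\<H>\<close> in \<open>W\<^sub>1\<close> (\<open>curvature_terms\<close>).

  The sum of both differences is the asserted formula (\<open>CF_eq\<close>). Its first term is tangential
  and the other two are normal, so it splits into the two stated equations, and \<open>d\<phi>\<close> can be
  removed from the first one because it is injective.

  Underneath lies Riemannian geometry in one chart. Its computations rest on a
  product rule for expressions \<open>B\<^sub>x(U(x),V(x))\<close> with \<open>B\<^sub>x\<close> bilinear, which covers metrics,
  Christoffel forms and differentials alike, and on the symmetry of second derivatives.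
  The Levi-Civita connection is treated as the pull-back connection along the identity, so that metric compatibility, torsion-freeness and the
  formula for the curvature are proved once for both connections.\<close>

section \<open>Calculus of smooth maps on open sets\<close>

abbreviation D :: "('a::real_normed_vector \<Rightarrow> 'b::real_normed_vector) \<Rightarrow> 'a \<Rightarrow> 'a \<Rightarrow> 'b" where
  "D f x \<equiv> frechet_derivative f (at x)"

lemma D_eqI: "(f has_derivative f') (at x) \<Longrightarrow> D f x = f'"
  using frechet_derivative_at by metis

lemma has_D: "f differentiable (at x) \<Longrightarrow> (f has_derivative D f x) (at x)"
  by (simp add: frechet_derivative_works)

lemma D_compose:
  "f differentiable (at x) \<Longrightarrow> g differentiable (at (f x)) \<Longrightarrow> D (\<lambda>y. g (f y)) x v = D g (f x) (D f x v)"
  using D_eqI[OF has_derivative_compose[OF has_D has_D]] by metis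

lemma D_add:
  "f differentiable (at x) \<Longrightarrow> g differentiable (at x) \<Longrightarrow> D (\<lambda>y. f y + g y) x v = D f x v + D g x v"
  using D_eqI[OF has_derivative_add[OF has_D has_D]] by metis

lemma D_diff:
  "f differentiable (at x) \<Longrightarrow> g differentiable (at x) \<Longrightarrow> D (\<lambda>y. f y - g y) x v = D f x v - D g x v"
  using D_eqI[OF has_derivative_diff[OF has_D has_D]] by metis

lemma D_cong_open:
  assumes "open S" "x \<in> S" "\<And>y. y \<in> S \<Longrightarrow> f y = g y"
  shows "D f x = D g x"
proof -
  have "(f has_derivative f') (at x) \<longleftrightarrow> (g has_derivative f') (at x)" for f'
    using assms has_derivative_transform_within_open[of _ _ x UNIV S] by metis
  then show ?thesis unfolding frechet_derivative_def by simp
qed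

lemma Ck_on_cong:
  assumes "open S"
  shows "(\<And>x. x \<in> S \<Longrightarrow> f x = g x) \<Longrightarrow> Ck_on k S f \<Longrightarrow> Ck_on k S g"
proof (induction k arbitrary: f g)
  case 0
  then show ?case using continuous_on_cong by (metis Ck_on.simps(1))
next
  case (Suc k)
  have "g differentiable_on S"
    using Suc.prems by (metis Ck_on.simps(2) differentiable_on_def differentiable_transform_within zero_less_one)
  moreover have "Ck_on k S (\<lambda>x. D g x v)" for v
  proof (rule Suc.IH)
    show "D f x v = D g x v" if "x \<in> S" for x
      using D_cong_open[OF assms that] Suc.prems(1) by metis
    show "Ck_on k S (\<lambda>x. D f x v)" using Suc.prems by simp
  qed
  ultimately show ?case by simp
qed

lemma Ck_on_Suc_imp: "Ck_on (Suc k) S f \<Longrightarrow> Ck_on k S f"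
proof (induction k arbitrary: f)
  case 0
  then show ?case by (simp add: differentiable_imp_continuous_on)
qed auto

lemma Ck_on_subset: "Ck_on k S f \<Longrightarrow> T \<subseteq> S \<Longrightarrow> Ck_on k T f"
  by (induction k arbitrary: f) (auto intro: continuous_on_subset differentiable_on_subset)

lemma Ck_on_SucD:
  assumes "Ck_on (Suc k) S f" "open S" "x \<in> S"
  shows "f differentiable (at x)"
  using assms by (auto simp: differentiable_on_eq_differentiable_at)

text \<open>Induction on \<open>k\<close> with this rule reduces the closure properties of \<open>C\<^sup>k\<close> maps to their
  derivative formulas.\<close>

lemma Ck_on_SucI:
  assumes "open S" "\<And>x. x \<in> S \<Longrightarrow> (f has_derivative f' x) (at x)"
    and "\<And>v. Ck_on k S (\<lambda>x. f' x v)"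
  shows "Ck_on (Suc k) S f"
proof -
  have "f differentiable_on S"
    using assms(1,2) by (auto simp: differentiable_on_eq_differentiable_at differentiable_def)
  moreover have "Ck_on k S (\<lambda>x. D f x v)" for v
    by (rule Ck_on_cong[OF assms(1) _ assms(3)[of v]]) (simp add: D_eqI[OF assms(2)])
  ultimately show ?thesis by simp
qed

lemma Ck_on_const: "Ck_on k S (\<lambda>_. c)"
  by (induction k arbitrary: c) auto

lemma Ck_on_add:
  assumes "open S"
  shows "Ck_on k S f \<Longrightarrow> Ck_on k S g \<Longrightarrow> Ck_on k S (\<lambda>x. f x + g x)"
proof (induction k arbitrary: f g)
  case (Suc k)
  show ?case
  proof (rule Ck_on_SucI[OF assms, where f' = "\<lambda>x v. D f x v + D g x v"])
    show "((\<lambda>x. f x + g x) has_derivative (\<lambda>v. D f x v + D g x v)) (at x)" if "x \<in> S" for x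
      using that Suc.prems assms by (intro has_derivative_add has_D Ck_on_SucD)
    show "Ck_on k S (\<lambda>x. D f x v + D g x v)" for v
      using Suc.prems by (intro Suc.IH) auto
  qed
qed (auto intro: continuous_on_add)

lemma Ck_on_sum:
  assumes "open S"
  shows "(\<And>i. i \<in> I \<Longrightarrow> Ck_on k S (f i)) \<Longrightarrow> Ck_on k S (\<lambda>x. \<Sum>i\<in>I. f i x)"
  by (induction I rule: infinite_finite_induct) (auto intro: Ck_on_const Ck_on_add[OF assms])

lemma (in bounded_bilinear) Ck_on_prod:
  assumes "open S"
  shows "Ck_on k S f \<Longrightarrow> Ck_on k S g \<Longrightarrow> Ck_on k S (\<lambda>x. prod (f x) (g x))"
proof (induction k arbitrary: f g)
  case (Suc k)
  show ?case
  proof (rule Ck_on_SucI[OF assms, where f' = "\<lambda>x v. prod (f x) (D g x v) + prod (D f x v) (g x)"])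
    show "((\<lambda>x. prod (f x) (g x)) has_derivative (\<lambda>v. prod (f x) (D g x v) + prod (D f x v) (g x))) (at x)"
      if "x \<in> S" for x
      using that Suc.prems assms by (intro FDERIV has_D Ck_on_SucD)
    show "Ck_on k S (\<lambda>x. prod (f x) (D g x v) + prod (D f x v) (g x))" for v
      using Suc.prems by (intro Ck_on_add[OF assms] Suc.IH Ck_on_Suc_imp[OF Suc.prems(1)] Ck_on_Suc_imp[OF Suc.prems(2)]) auto
  qed
qed (auto intro: continuous_on)

lemma Ck_on_inverse:
  fixes f :: "'a::euclidean_space \<Rightarrow> real"
  assumes "open S" "\<And>x. x \<in> S \<Longrightarrow> f x \<noteq> 0"
  shows "Ck_on k S f \<Longrightarrow> Ck_on k S (\<lambda>x. inverse (f x))"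
proof (induction k)
  case 0
  then show ?case using assms(2) by (auto intro: continuous_on_inverse)
next
  case (Suc k)
  show ?case
  proof (rule Ck_on_SucI[OF assms(1), where f' = "\<lambda>x v. - 1 * (inverse (f x) * D f x v * inverse (f x))"])
    show "((\<lambda>x. inverse (f x)) has_derivative (\<lambda>v. - 1 * (inverse (f x) * D f x v * inverse (f x)))) (at x)"
      if "x \<in> S" for x
      using Deriv.has_derivative_inverse[OF assms(2)[OF that] has_D[OF Ck_on_SucD[OF Suc.prems assms(1) that]]] by simp
    show "Ck_on k S (\<lambda>x. - 1 * (inverse (f x) * D f x v * inverse (f x)))" for v
      using Suc.prems Ck_on_Suc_imp[OF Suc.prems]
      by (intro bounded_bilinear.Ck_on_prod[OF bounded_bilinear_mult assms(1)] Suc.IH Ck_on_const) auto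
  qed
qed

lemma linear_family_expand:
  fixes u :: "'a::euclidean_space"
  assumes "linear L"
  shows "L u = (\<Sum>b\<in>Basis. (u \<bullet> b) *\<^sub>R L b)"
proof -
  have "L u = L (\<Sum>b\<in>Basis. (u \<bullet> b) *\<^sub>R b)" by (simp only: euclidean_representation)
  also have "\<dots> = (\<Sum>b\<in>Basis. (u \<bullet> b) *\<^sub>R L b)"
    by (simp only: linear_sum[OF assms] linear_cmul[OF assms])
  finally show ?thesis .
qed

lemma Ck_on_linear_family:
  fixes L :: "'a::euclidean_space \<Rightarrow> 'b::euclidean_space \<Rightarrow> 'c::real_normed_vector"
  assumes S: "open S" and lin: "\<And>x. x \<in> S \<Longrightarrow> linear (L x)"
    and "\<And>b. Ck_on k S (\<lambda>x. L x b)" and "Ck_on k S U"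
  shows "Ck_on k S (\<lambda>x. L x (U x))"
proof (rule Ck_on_cong[OF S])
  show "(\<Sum>b\<in>Basis. (U x \<bullet> b) *\<^sub>R L x b) = L x (U x)" if "x \<in> S" for x
    by (rule linear_family_expand[OF lin[OF that], symmetric])
  show "Ck_on k S (\<lambda>x. \<Sum>b\<in>Basis. (U x \<bullet> b) *\<^sub>R L x b)"
    using assms by (intro Ck_on_sum[OF S] bounded_bilinear.Ck_on_prod[OF bounded_bilinear_scaleR S]
      bounded_bilinear.Ck_on_prod[OF bounded_bilinear_inner S] Ck_on_const)
qed

lemma Ck_on_compose:
  fixes f :: "'a::euclidean_space \<Rightarrow> 'b::euclidean_space" and g :: "'b \<Rightarrow> 'c::real_normed_vector"
  assumes S: "open S" and T: "open T" and fS: "f ` S \<subseteq> T"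
  shows "Ck_on k S f \<Longrightarrow> Ck_on k T g \<Longrightarrow> Ck_on k S (\<lambda>x. g (f x))"
proof (induction k arbitrary: g)
  case 0
  then show ?case using fS by (auto intro: continuous_on_compose2)
next
  case (Suc k)
  have g: "g differentiable (at (f x))" if "x \<in> S" for x
    using Ck_on_SucD[OF Suc.prems(2) T] fS that by auto
  show ?case
  proof (rule Ck_on_SucI[OF S, where f' = "\<lambda>x v. D g (f x) (D f x v)"])
    show "((\<lambda>x. g (f x)) has_derivative (\<lambda>v. D g (f x) (D f x v))) (at x)" if "x \<in> S" for x
      using has_derivative_compose[OF has_D[OF Ck_on_SucD[OF Suc.prems(1) S that]] has_D[OF g[OF that]]] by simp
    show "Ck_on k S (\<lambda>x. D g (f x) (D f x v))" for v
    proof (rule Ck_on_linear_family[OF S])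
      show "linear (D g (f x))" if "x \<in> S" for x
        using g[OF that] by (rule linear_frechet_derivative)
      show "Ck_on k S (\<lambda>x. D g (f x) b)" for b
        using Suc.prems by (intro Suc.IH Ck_on_Suc_imp[OF Suc.prems(1)]) auto
      show "Ck_on k S (\<lambda>x. D f x v)" using Suc.prems by simp
    qed
  qed
qed

lemma smooth_on_subset: "smooth_on S f \<Longrightarrow> T \<subseteq> S \<Longrightarrow> smooth_on T f"
  by (auto simp: smooth_on_def intro: Ck_on_subset)

lemma smooth_on_cong:
  "open S \<Longrightarrow> smooth_on S f \<Longrightarrow> (\<And>x. x \<in> S \<Longrightarrow> f x = g x) \<Longrightarrow> smooth_on S g"
  unfolding smooth_on_def using Ck_on_cong by blast

lemma smooth_on_differentiable:
  "smooth_on S f \<Longrightarrow> open S \<Longrightarrow> x \<in> S \<Longrightarrow> f differentiable (at x)"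
  unfolding smooth_on_def using Ck_on_SucD by blast

lemma smooth_on_D: "smooth_on S f \<Longrightarrow> smooth_on S (\<lambda>x. D f x v)"
  unfolding smooth_on_def using Ck_on.simps(2) by blast

lemma smooth_on_const: "smooth_on S (\<lambda>_. c)"
  by (simp add: smooth_on_def Ck_on_const)

lemma smooth_on_ident: "smooth_on S (\<lambda>x. x)"
proof -
  have "Ck_on k S (\<lambda>x. x)" for k
    by (cases k) (auto simp: Ck_on_const)
  then show ?thesis by (simp add: smooth_on_def)
qed

lemma smooth_on_add:
  "open S \<Longrightarrow> smooth_on S f \<Longrightarrow> smooth_on S g \<Longrightarrow> smooth_on S (\<lambda>x. f x + g x)"
  by (simp add: smooth_on_def Ck_on_add)

lemma smooth_on_sum:
  "open S \<Longrightarrow> (\<And>i. i \<in> I \<Longrightarrow> smooth_on S (f i)) \<Longrightarrow> smooth_on S (\<lambda>x. \<Sum>i\<in>I. f i x)"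
  by (simp add: smooth_on_def Ck_on_sum)

lemma smooth_on_scaleR:
  "open S \<Longrightarrow> smooth_on S a \<Longrightarrow> smooth_on S f \<Longrightarrow> smooth_on S (\<lambda>x. a x *\<^sub>R f x)"
  by (simp add: smooth_on_def bounded_bilinear.Ck_on_prod[OF bounded_bilinear_scaleR])

lemma smooth_on_mult:
  fixes f g :: "'a::euclidean_space \<Rightarrow> real"
  shows "open S \<Longrightarrow> smooth_on S f \<Longrightarrow> smooth_on S g \<Longrightarrow> smooth_on S (\<lambda>x. f x * g x)"
  by (simp add: smooth_on_def bounded_bilinear.Ck_on_prod[OF bounded_bilinear_mult])

lemma smooth_on_diff:
  assumes "open S" "smooth_on S f" "smooth_on S g"
  shows "smooth_on S (\<lambda>x. f x - g x)"
  using smooth_on_add[OF assms(1,2) smooth_on_scaleR[OF assms(1) smooth_on_const[of S "-1"] assms(3)]] by simp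

lemma smooth_on_prod:
  fixes f :: "'i \<Rightarrow> 'a::euclidean_space \<Rightarrow> real"
  assumes "open S"
  shows "(\<And>i. i \<in> I \<Longrightarrow> smooth_on S (f i)) \<Longrightarrow> smooth_on S (\<lambda>x. \<Prod>i\<in>I. f i x)"
  by (induction I rule: infinite_finite_induct) (auto intro: smooth_on_const smooth_on_mult[OF assms])

lemma smooth_on_inverse:
  fixes f :: "'a::euclidean_space \<Rightarrow> real"
  shows "open S \<Longrightarrow> smooth_on S f \<Longrightarrow> (\<And>x. x \<in> S \<Longrightarrow> f x \<noteq> 0) \<Longrightarrow> smooth_on S (\<lambda>x. inverse (f x))"
  by (simp add: smooth_on_def Ck_on_inverse)

lemma smooth_on_compose:
  fixes f :: "'a::euclidean_space \<Rightarrow> 'b::euclidean_space" and g :: "'b \<Rightarrow> 'c::real_normed_vector"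
  shows "open S \<Longrightarrow> open T \<Longrightarrow> f ` S \<subseteq> T \<Longrightarrow> smooth_on S f \<Longrightarrow> smooth_on T g \<Longrightarrow> smooth_on S (\<lambda>x. g (f x))"
  by (simp add: smooth_on_def Ck_on_compose)

lemma smooth_on_linear_family:
  fixes L :: "'a::euclidean_space \<Rightarrow> 'b::euclidean_space \<Rightarrow> 'c::real_normed_vector"
  assumes "open S" "\<And>x. x \<in> S \<Longrightarrow> linear (L x)" "\<And>b. smooth_on S (\<lambda>x. L x b)" "smooth_on S U"
  shows "smooth_on S (\<lambda>x. L x (U x))"
  using assms by (auto simp: smooth_on_def intro: Ck_on_linear_family)

text \<open>Metrics and Christoffel forms are pointwise bilinear maps whose values on fixed vectors are
  smooth; this rule lets smooth vector fields be inserted.\<close>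

lemma smooth_on_bilinear_family:
  fixes B :: "'a::euclidean_space \<Rightarrow> 'b::euclidean_space \<Rightarrow> 'd::euclidean_space \<Rightarrow> 'c::real_normed_vector"
  assumes "open S" "\<And>x. x \<in> S \<Longrightarrow> bilinear (B x)" "\<And>a b. smooth_on S (\<lambda>x. B x a b)"
    and "smooth_on S U" "smooth_on S V"
  shows "smooth_on S (\<lambda>x. B x (U x) (V x))"
proof (rule smooth_on_linear_family[OF assms(1), where L = "\<lambda>x. B x (U x)"])
  show "linear (B x (U x))" if "x \<in> S" for x using assms(2)[OF that] by (simp add: bilinear_def)
  show "smooth_on S (\<lambda>x. B x (U x) b)" for b
  proof (rule smooth_on_linear_family[OF assms(1), where L = "\<lambda>x u. B x u b"])
    show "linear (\<lambda>u. B x u b)" if "x \<in> S" for x using assms(2)[OF that] by (simp add: bilinear_def)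
  qed (rule assms)+
qed (rule assms)

lemma smooth_on_vec_lambda:
  fixes F :: "'a::euclidean_space \<Rightarrow> 'n::finite \<Rightarrow> real"
  assumes "open S" "\<And>k. smooth_on S (\<lambda>x. F x k)"
  shows "smooth_on S (\<lambda>x. \<chi> k. F x k)"
proof -
  have "(\<chi> k. F x k) = (\<Sum>k\<in>UNIV. F x k *\<^sub>R axis k 1)" for x
    using basis_expansion[of "\<chi> k. F x k"] by (simp add: scalar_mult_eq_scaleR)
  then show ?thesis
    using assms by (auto intro!: smooth_on_sum smooth_on_scaleR smooth_on_const)
qed

lemma smooth_on_D_field:
  fixes f :: "'a::euclidean_space \<Rightarrow> 'b::real_normed_vector"
  assumes "open S" "smooth_on S f" "smooth_on S U"
  shows "smooth_on S (\<lambda>x. D f x (U x))"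
proof (rule smooth_on_linear_family[OF assms(1) _ _ assms(3)])
  show "linear (D f x)" if "x \<in> S" for x
    by (rule linear_frechet_derivative[OF smooth_on_differentiable[OF assms(2,1) that]])
qed (rule smooth_on_D[OF assms(2)])

section \<open>Product rules for families of linear and bilinear maps\<close>

text \<open>The derivative is taken with respect to the parameter only, so it inherits linearity in the
  argument.\<close>

lemma linear_D_family:
  fixes L :: "'a::real_normed_vector \<Rightarrow> 'b::real_vector \<Rightarrow> 'c::real_normed_vector"
  assumes S: "open S" "x \<in> S" and lin: "\<And>y. y \<in> S \<Longrightarrow> linear (L y)"
    and diff: "\<And>b. (\<lambda>y. L y b) differentiable (at x)"
  shows "linear (\<lambda>b. D (\<lambda>y. L y b) x v)"
proof
  fix a b :: 'b and r :: real
  have "D (\<lambda>y. L y (a + b)) x = D (\<lambda>y. L y a + L y b) x"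
    by (rule D_cong_open[OF S]) (simp add: lin linear_add)
  also have "\<dots> = (\<lambda>v. D (\<lambda>y. L y a) x v + D (\<lambda>y. L y b) x v)"
    by (intro D_eqI has_derivative_add has_D diff)
  finally show "D (\<lambda>y. L y (a + b)) x v = D (\<lambda>y. L y a) x v + D (\<lambda>y. L y b) x v" by simp
  have "D (\<lambda>y. L y (r *\<^sub>R b)) x = D (\<lambda>y. r *\<^sub>R L y b) x"
    by (rule D_cong_open[OF S]) (simp add: lin linear_cmul)
  also have "\<dots> = (\<lambda>v. r *\<^sub>R D (\<lambda>y. L y b) x v)"
    by (intro D_eqI has_derivative_scaleR_right has_D diff)
  finally show "D (\<lambda>y. L y (r *\<^sub>R b)) x v = r *\<^sub>R D (\<lambda>y. L y b) x v" by simp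
qed

text \<open>Expanding the argument in a basis turns the expression into a finite sum of products of
  differentiable functions, to which the usual product rule applies.\<close>

lemma has_derivative_linear_family:
  fixes L :: "'a::real_normed_vector \<Rightarrow> 'b::euclidean_space \<Rightarrow> 'c::real_normed_vector"
  assumes S: "open S" "x \<in> S" and lin: "\<And>y. y \<in> S \<Longrightarrow> linear (L y)"
    and diff: "\<And>b. (\<lambda>y. L y b) differentiable (at x)"
    and U: "U differentiable (at x)"
  shows "((\<lambda>y. L y (U y)) has_derivative (\<lambda>v. D (\<lambda>y. L y (U x)) x v + L x (D U x v))) (at x)"
proof -
  let ?L' = "\<lambda>v b. D (\<lambda>y. L y b) x v"
  let ?E = "\<lambda>y. \<Sum>b\<in>Basis. (U y \<bullet> b) *\<^sub>R L y b"
  have "(?E has_derivative (\<lambda>v. \<Sum>b\<in>Basis. (U x \<bullet> b) *\<^sub>R ?L' v b + (D U x v \<bullet> b) *\<^sub>R L x b)) (at x)"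
    by (intro has_derivative_sum has_derivative_scaleR has_derivative_inner_left has_D diff U)
  moreover have "(\<Sum>b\<in>Basis. (U x \<bullet> b) *\<^sub>R ?L' v b + (D U x v \<bullet> b) *\<^sub>R L x b) = ?L' v (U x) + L x (D U x v)" for v
    by (simp only: sum.distrib linear_family_expand[OF linear_D_family[OF S lin diff], of "U x" v]
        linear_family_expand[OF lin[OF S(2)], of "D U x v"])
  ultimately have "(?E has_derivative (\<lambda>v. ?L' v (U x) + L x (D U x v))) (at x)" by simp
  then show ?thesis
    by (rule has_derivative_transform_within_open[OF _ S]) (rule linear_family_expand[OF lin, symmetric])
qed

lemma has_derivative_bilinear_family:
  fixes B :: "'a::real_normed_vector \<Rightarrow> 'b::euclidean_space \<Rightarrow> 'd::euclidean_space \<Rightarrow> 'c::real_normed_vector"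
  assumes S: "open S" "x \<in> S" and bil: "\<And>y. y \<in> S \<Longrightarrow> bilinear (B y)"
    and diff: "\<And>a b. (\<lambda>y. B y a b) differentiable (at x)"
    and U: "U differentiable (at x)" and V: "V differentiable (at x)"
  shows "((\<lambda>y. B y (U y) (V y)) has_derivative
     (\<lambda>v. D (\<lambda>y. B y (U x) (V x)) x v + B x (D U x v) (V x) + B x (U x) (D V x v))) (at x)"
proof -
  have bil': "linear (B y a)" "linear (\<lambda>a. B y a b)" if "y \<in> S" for y a b
    using bil[OF that] by (auto simp: bilinear_def)
  have inner: "((\<lambda>y. B y (U y) b) has_derivative (\<lambda>v. D (\<lambda>y. B y (U x) b) x v + B x (D U x v) b)) (at x)" for b
    by (rule has_derivative_linear_family[OF S, where L = "\<lambda>y a. B y a b"]) (rule bil' diff U | assumption)+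
  have "((\<lambda>y. B y (U y) (V y)) has_derivative
     (\<lambda>v. D (\<lambda>y. B y (U y) (V x)) x v + B x (U x) (D V x v))) (at x)"
    using inner differentiable_def
    by (intro has_derivative_linear_family[OF S, where L = "\<lambda>y. B y (U y)"] bil' V) blast+
  then show ?thesis by (simp add: D_eqI[OF inner] add.assoc)
qed

lemma bilinear_D_family:
  fixes B :: "'a::real_normed_vector \<Rightarrow> 'b::euclidean_space \<Rightarrow> 'd::euclidean_space \<Rightarrow> 'c::real_normed_vector"
  assumes S: "open S" "x \<in> S" and bil: "\<And>y. y \<in> S \<Longrightarrow> bilinear (B y)"
    and diff: "\<And>a b. (\<lambda>y. B y a b) differentiable (at x)"
  shows "bilinear (\<lambda>a b. D (\<lambda>y. B y a b) x v)"
  unfolding bilinear_def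
proof (intro conjI allI)
  have bil': "linear (B y a)" "linear (\<lambda>a. B y a b)" if "y \<in> S" for y a b
    using bil[OF that] by (auto simp: bilinear_def)
  show "linear (\<lambda>b. D (\<lambda>y. B y a b) x v)" for a
    by (rule linear_D_family[OF S, where L = "\<lambda>y. B y a"]) (rule bil' diff | assumption)+
  show "linear (\<lambda>a. D (\<lambda>y. B y a b) x v)" for b
    by (rule linear_D_family[OF S, where L = "\<lambda>y a. B y a b"]) (rule bil' diff | assumption)+
qed

lemma D_bilinear_family:
  fixes B :: "'a::real_normed_vector \<Rightarrow> 'b::euclidean_space \<Rightarrow> 'd::euclidean_space \<Rightarrow> 'c::real_normed_vector"
  assumes "open S" "x \<in> S" "\<And>y. y \<in> S \<Longrightarrow> bilinear (B y)"
    and "\<And>a b. (\<lambda>y. B y a b) differentiable (at x)"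
    and "U differentiable (at x)" "V differentiable (at x)"
  shows "D (\<lambda>y. B y (U y) (V y)) x v = D (\<lambda>y. B y (U x) (V x)) x v + B x (D U x v) (V x) + B x (U x) (D V x v)"
  by (simp add: D_eqI[OF has_derivative_bilinear_family[OF assms]])

lemma D_field:
  fixes f :: "'a::euclidean_space \<Rightarrow> 'b::real_normed_vector"
  assumes "open S" "x \<in> S" "smooth_on S f" "U differentiable (at x)"
  shows "D (\<lambda>y. D f y (U y)) x v = D (\<lambda>y. D f y (U x)) x v + D f x (D U x v)"
proof -
  have "((\<lambda>y. D f y (U y)) has_derivative (\<lambda>v. D (\<lambda>y. D f y (U x)) x v + D f x (D U x v))) (at x)"
  proof (rule has_derivative_linear_family[OF assms(1,2), where L = "D f"])
    show "linear (D f y)" if "y \<in> S" for y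
      by (rule linear_frechet_derivative[OF smooth_on_differentiable[OF assms(3,1) that]])
    show "(\<lambda>y. D f y b) differentiable (at x)" for b
      by (rule smooth_on_differentiable[OF smooth_on_D[OF assms(3)] assms(1,2)])
  qed (rule assms)
  then show ?thesis by (simp add: D_eqI)
qed

section \<open>Symmetry of second derivatives\<close>

text \<open>The second difference over a parallelogram is symmetric in its two sides. Applying the mean
  value theorem along one side and then along the other expresses it by a mixed second
  derivative at an intermediate point.\<close>

lemma second_difference_mvt:
  fixes f :: "'a::euclidean_space \<Rightarrow> real"
  assumes S: "open S" and f: "Ck_on 2 S f" and t: "t > 0"
    and sub: "\<And>a b. 0 \<le> a \<Longrightarrow> a \<le> t \<Longrightarrow> 0 \<le> b \<Longrightarrow> b \<le> t \<Longrightarrow> x + a *\<^sub>R u + b *\<^sub>R v \<in> S"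
  obtains a b where "0 \<le> a" "a \<le> t" "0 \<le> b" "b \<le> t"
    "f (x + t *\<^sub>R u + t *\<^sub>R v) - f (x + t *\<^sub>R u) - f (x + t *\<^sub>R v) + f x
      = t * t * D (\<lambda>y. D f y u) (x + a *\<^sub>R u + b *\<^sub>R v) v"
proof -
  have C: "Ck_on (Suc 0) S (\<lambda>y. D f y u)" "Ck_on (Suc 1) S f" using f by (auto simp: numeral_2_eq_2)
  let ?F = "\<lambda>s. f (x + s *\<^sub>R u + t *\<^sub>R v) - f (x + s *\<^sub>R u)"
  have F: "(?F has_real_derivative (D f (x + s *\<^sub>R u + t *\<^sub>R v) u - D f (x + s *\<^sub>R u) u)) (at s)"
    if "0 \<le> s" "s \<le> t" for s
  proof -
    have "f differentiable at (x + s *\<^sub>R u + t *\<^sub>R v)" "f differentiable at (x + s *\<^sub>R u)"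
      using sub[of s t] sub[of s 0] that t Ck_on_SucD[OF C(2) S] by auto
    note d = this[THEN has_D]
    have "((\<lambda>s. x + s *\<^sub>R u + t *\<^sub>R v) has_derivative (\<lambda>h. h *\<^sub>R u)) (at s)"
      "((\<lambda>s. x + s *\<^sub>R u) has_derivative (\<lambda>h. h *\<^sub>R u)) (at s)"
      by (auto intro!: derivative_eq_intros)
    from has_derivative_diff[OF has_derivative_compose[OF this(1), of f] has_derivative_compose[OF this(2), of f]] d
    have "(?F has_derivative (\<lambda>h. D f (x + s *\<^sub>R u + t *\<^sub>R v) (h *\<^sub>R u) - D f (x + s *\<^sub>R u) (h *\<^sub>R u))) (at s)"
      by blast
    moreover have "D f (x + s *\<^sub>R u + t *\<^sub>R v) (h *\<^sub>R u) = h * D f (x + s *\<^sub>R u + t *\<^sub>R v) u"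
      "D f (x + s *\<^sub>R u) (h *\<^sub>R u) = h * D f (x + s *\<^sub>R u) u" for h
      using d[THEN has_derivative_linear] by (simp_all add: linear_cmul)
    then have "(\<lambda>h. D f (x + s *\<^sub>R u + t *\<^sub>R v) (h *\<^sub>R u) - D f (x + s *\<^sub>R u) (h *\<^sub>R u))
        = (*) (D f (x + s *\<^sub>R u + t *\<^sub>R v) u - D f (x + s *\<^sub>R u) u)"
      by (simp add: fun_eq_iff left_diff_distrib right_diff_distrib mult.commute)
    ultimately show ?thesis by (simp only: has_field_derivative_def)
  qed
  obtain a where a: "0 < a" "a < t" "?F t - ?F 0 = (t - 0) * (D f (x + a *\<^sub>R u + t *\<^sub>R v) u - D f (x + a *\<^sub>R u) u)"
    using MVT2[OF t F] by auto
  let ?K = "\<lambda>s. D f (x + a *\<^sub>R u + s *\<^sub>R v) u"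
  have K: "(?K has_real_derivative D (\<lambda>y. D f y u) (x + a *\<^sub>R u + s *\<^sub>R v) v) (at s)"
    if "0 \<le> s" "s \<le> t" for s
  proof -
    have "(\<lambda>y. D f y u) differentiable at (x + a *\<^sub>R u + s *\<^sub>R v)"
      using sub[of a s] that a t Ck_on_SucD[OF C(1) S] by auto
    note d = this[THEN has_D]
    have "((\<lambda>s. x + a *\<^sub>R u + s *\<^sub>R v) has_derivative (\<lambda>h. h *\<^sub>R v)) (at s)"
      by (auto intro!: derivative_eq_intros)
    from has_derivative_compose[OF this, of "\<lambda>y. D f y u"] d
    have "(?K has_derivative (\<lambda>h. D (\<lambda>y. D f y u) (x + a *\<^sub>R u + s *\<^sub>R v) (h *\<^sub>R v))) (at s)"
      by blast
    moreover have "(\<lambda>h. D (\<lambda>y. D f y u) (x + a *\<^sub>R u + s *\<^sub>R v) (h *\<^sub>R v))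
        = (*) (D (\<lambda>y. D f y u) (x + a *\<^sub>R u + s *\<^sub>R v) v)"
      using d[THEN has_derivative_linear] by (simp add: fun_eq_iff linear_cmul mult.commute)
    ultimately show ?thesis by (simp only: has_field_derivative_def)
  qed
  obtain b where b: "0 < b" "b < t" "?K t - ?K 0 = (t - 0) * D (\<lambda>y. D f y u) (x + a *\<^sub>R u + b *\<^sub>R v) v"
    using MVT2[OF t K] by auto
  show ?thesis using that[of a b] a b by (simp add: algebra_simps)
qed

text \<open>Both mixed derivatives are limits of the same second difference quotient. So if they differed
  at \<open>x\<close>, continuity would keep them apart near \<open>x\<close>, while on small parallelograms they share
  values.\<close>

lemma second_derivative_symmetric_real:
  fixes f :: "'a::euclidean_space \<Rightarrow> real"
  assumes S: "open S" "x \<in> S" and f: "Ck_on 2 S f"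
  shows "D (\<lambda>y. D f y u) x v = D (\<lambda>y. D f y v) x u"
proof (rule ccontr)
  let ?E = "\<lambda>y. D (\<lambda>y. D f y u) y v" and ?H = "\<lambda>y. D (\<lambda>y. D f y v) y u"
  assume ne: "?E x \<noteq> ?H x"
  define \<epsilon> where "\<epsilon> = \<bar>?E x - ?H x\<bar> / 2"
  have "\<epsilon> > 0" using ne by (simp add: \<epsilon>_def)
  have "continuous_on S ?E" "continuous_on S ?H" using f by (auto simp: numeral_2_eq_2)
  then have "isCont ?E x" "isCont ?H x" using S by (auto simp: continuous_on_eq_continuous_at)
  then obtain d1 d2 where d: "d1 > 0" "d2 > 0" "\<And>y. dist y x < d1 \<Longrightarrow> \<bar>?E y - ?E x\<bar> < \<epsilon>"
    "\<And>y. dist y x < d2 \<Longrightarrow> \<bar>?H y - ?H x\<bar> < \<epsilon>"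
    using \<open>\<epsilon> > 0\<close> unfolding continuous_at_eps_delta dist_real_def by metis
  obtain d3 where d3: "d3 > 0" "\<And>y. dist y x < d3 \<Longrightarrow> y \<in> S" using S open_dist by metis
  define \<delta> where "\<delta> = min d1 (min d2 d3)"
  \<comment> \<open>The parallelogram at \<open>x\<close> with sides \<open>t u\<close> and \<open>t v\<close> lies in the ball of radius \<open>\<delta>\<close>; adding 1 avoids division by zero.\<close>
  define t where "t = \<delta> / (norm u + norm v + 1)"
  have "\<delta> > 0" using d d3 by (simp add: \<delta>_def)
  have N: "norm u + norm v + 1 > 0" by (smt (verit) norm_ge_zero)
  then have t: "t > 0" using \<open>\<delta> > 0\<close> by (simp add: t_def)
  have near: "dist (x + a *\<^sub>R p + b *\<^sub>R q) x < \<delta>"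
    if "0 \<le> a" "a \<le> t" "0 \<le> b" "b \<le> t" "norm p + norm q = norm u + norm v" for a b p q
  proof -
    have "dist (x + a *\<^sub>R p + b *\<^sub>R q) x \<le> a * norm p + b * norm q"
      using that norm_triangle_ineq[of "a *\<^sub>R p" "b *\<^sub>R q"] by (simp add: dist_norm add.assoc)
    also have "\<dots> \<le> t * norm p + t * norm q" using that by (intro add_mono mult_right_mono) auto
    also have "\<dots> = t * (norm u + norm v)" using that by (simp flip: distrib_left)
    also have "\<dots> < t * (norm u + norm v + 1)" using t by simp
    also have "\<dots> = \<delta>" using N by (simp add: t_def)
    finally show ?thesis .
  qed
  obtain a b where ab: "0 \<le> a" "a \<le> t" "0 \<le> b" "b \<le> t"
    "f (x + t *\<^sub>R u + t *\<^sub>R v) - f (x + t *\<^sub>R u) - f (x + t *\<^sub>R v) + f x = t * t * ?E (x + a *\<^sub>R u + b *\<^sub>R v)"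
    using second_difference_mvt[OF S(1) f t, of x u v] near[of _ _ u v] d3 unfolding \<delta>_def
    by (smt (verit, ccfv_SIG) min_less_iff_conj)
  obtain a' b' where ab': "0 \<le> a'" "a' \<le> t" "0 \<le> b'" "b' \<le> t"
    "f (x + t *\<^sub>R v + t *\<^sub>R u) - f (x + t *\<^sub>R v) - f (x + t *\<^sub>R u) + f x = t * t * ?H (x + a' *\<^sub>R v + b' *\<^sub>R u)"
    using second_difference_mvt[OF S(1) f t, of x v u] near[of _ _ v u] d3 unfolding \<delta>_def
    by (smt (verit, ccfv_SIG) min_less_iff_conj)
  have "t * t * ?E (x + a *\<^sub>R u + b *\<^sub>R v) = t * t * ?H (x + a' *\<^sub>R v + b' *\<^sub>R u)"
    using ab(5) ab'(5) by (simp add: algebra_simps)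
  then have "?E (x + a *\<^sub>R u + b *\<^sub>R v) = ?H (x + a' *\<^sub>R v + b' *\<^sub>R u)" using t by simp
  moreover have "\<bar>?E (x + a *\<^sub>R u + b *\<^sub>R v) - ?E x\<bar> < \<epsilon>"
    using near[OF ab(1-4)] by (intro d) (simp add: \<delta>_def)
  moreover have "\<bar>?H (x + a' *\<^sub>R v + b' *\<^sub>R u) - ?H x\<bar> < \<epsilon>"
    using near[OF ab'(1-4)] by (intro d) (simp add: \<delta>_def)
  ultimately show False unfolding \<epsilon>_def by argo
qed

lemma second_derivative_symmetric:
  fixes f :: "'a::euclidean_space \<Rightarrow> 'b::euclidean_space"
  assumes S: "open S" "x \<in> S" and f: "smooth_on S f"
  shows "D (\<lambda>y. D f y u) x v = D (\<lambda>y. D f y v) x u"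
proof (rule euclidean_eqI)
  fix b :: 'b
  have D1: "D (\<lambda>y. g y \<bullet> b) y w = D g y w \<bullet> b" if "g differentiable at y" for g :: "'a \<Rightarrow> 'b" and y w
    using D_eqI[OF has_derivative_inner_left[OF has_D[OF that]]] by simp
  have D2: "D (\<lambda>y. D (\<lambda>y. f y \<bullet> b) y w) x w' = D (\<lambda>y. D f y w) x w' \<bullet> b" for w w'
  proof -
    have "D (\<lambda>y. D (\<lambda>y. f y \<bullet> b) y w) x = D (\<lambda>y. D f y w \<bullet> b) x"
      using S D1 smooth_on_differentiable[OF f] by (intro D_cong_open[of S]) auto
    then show ?thesis using D1[OF smooth_on_differentiable[OF smooth_on_D[OF f] S]] by simp
  qed
  have "Ck_on 2 S (\<lambda>y. f y \<bullet> b)"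
    using f by (auto simp: smooth_on_def intro: bounded_bilinear.Ck_on_prod[OF bounded_bilinear_inner S(1)] Ck_on_const)
  from second_derivative_symmetric_real[OF S this] show "D (\<lambda>y. D f y u) x v \<bullet> b = D (\<lambda>y. D f y v) x u \<bullet> b"
    by (simp add: D2)
qed

section \<open>The Levi-Civita connection of a metric on a coordinate domain\<close>

lemma matrix_inv_right:
  fixes A :: "real ^ 'k::finite ^ 'k"
  shows "invertible A \<Longrightarrow> A ** matrix_inv A = mat 1"
  unfolding invertible_def matrix_inv_def by (rule someI_ex[THEN conjunct1])

text \<open>Cramer's rule exhibits the entries of the inverse as quotients of determinants, which is how
  the inverse of a smooth matrix function is seen to be smooth.\<close>

lemma matrix_inv_cramer:
  fixes A :: "real ^ 'k::finite ^ 'k"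
  assumes "invertible A"
  shows "matrix_inv A $ k $ l = det (\<chi> i j. if j = k then axis l 1 $ i else A $ i $ j) / det A"
proof -
  have d: "det A \<noteq> 0" using assms by (simp add: invertible_det_nz)
  have "A *v (matrix_inv A *v axis l 1) = axis l 1"
    by (simp add: matrix_vector_mul_assoc matrix_inv_right[OF assms])
  then have "matrix_inv A *v axis l 1 = (\<chi> k. det (\<chi> i j. if j = k then axis l 1 $ i else A $ i $ j) / det A)"
    using cramer[OF d] by blast
  moreover have "(matrix_inv A *v axis l 1) $ k = matrix_inv A $ k $ l"
    by (simp add: matrix_vector_mult_basis column_def)
  ultimately show ?thesis by simp
qed

lemma linear_axis_sum:
  fixes L :: "real ^ 'k::finite \<Rightarrow> real"
  assumes "linear L"
  shows "L u = (\<Sum>i\<in>UNIV. u $ i * L (axis i 1))"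
proof -
  have "L u = L (\<Sum>i\<in>UNIV. u $ i *\<^sub>R axis i 1)"
    using basis_expansion[of u] by (simp add: scalar_mult_eq_scaleR)
  then show ?thesis by (simp only: linear_sum[OF assms] linear_cmul[OF assms] real_scaleR_def)
qed

lemma smooth_on_det:
  fixes A :: "'a::euclidean_space \<Rightarrow> real ^ 'k::finite ^ 'k"
  assumes S: "open S" and A: "\<And>i j. smooth_on S (\<lambda>x. A x $ i $ j)"
  shows "smooth_on S (\<lambda>x. det (A x))"
  unfolding det_def
  by (intro smooth_on_sum[OF S] smooth_on_mult[OF S] smooth_on_const smooth_on_prod[OF S] A)

locale riemannian_domain =
  fixes T :: "(real ^ 'n::finite) set" and H :: "'n local_metric"
  assumes open_T: "open T" and metric: "local_riemannian_metric T H"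
begin

abbreviation \<Gamma> :: "real ^ 'n \<Rightarrow> real ^ 'n \<Rightarrow> real ^ 'n \<Rightarrow> real ^ 'n" where
  "\<Gamma> \<equiv> christoffel_form H"

lemma bilinear_H: "x \<in> T \<Longrightarrow> bilinear (H x)"
  and H_sym: "x \<in> T \<Longrightarrow> H x u v = H x v u"
  and H_pos: "x \<in> T \<Longrightarrow> u \<noteq> 0 \<Longrightarrow> H x u u > 0"
  and smooth_H: "smooth_on T (\<lambda>x. H x u v)"
  using metric unfolding local_riemannian_metric_def by blast+

lemmas H_ladd = bilinear_ladd[OF bilinear_H] and H_radd = bilinear_radd[OF bilinear_H]
  and H_lsub = bilinear_lsub[OF bilinear_H] and H_rsub = bilinear_rsub[OF bilinear_H]
  and H_lmul = bilinear_lmul[OF bilinear_H] and H_rmul = bilinear_rmul[OF bilinear_H]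
  and H_lneg = bilinear_lneg[OF bilinear_H]
  and H_lzero = bilinear_lzero[OF bilinear_H] and H_rzero = bilinear_rzero[OF bilinear_H]

lemma linear_H: "x \<in> T \<Longrightarrow> linear (H x u)" "x \<in> T \<Longrightarrow> linear (\<lambda>u. H x u v)"
  using bilinear_H by (auto simp: bilinear_def)

lemma H_nondegenerate: "x \<in> T \<Longrightarrow> (\<And>v. H x u v = 0) \<Longrightarrow> u = 0"
  using H_pos[of x u] by force

lemma H_eqI: "x \<in> T \<Longrightarrow> (\<And>v. H x u v = H x w v) \<Longrightarrow> u = w"
  using H_nondegenerate[of x "u - w"] by (simp add: H_lsub)

lemma H_gram: "x \<in> T \<Longrightarrow> H x u v = u \<bullet> (gram_matrix H x *v v)"
proof -
  assume x: "x \<in> T"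
  have "H x u v = H x (\<Sum>i\<in>UNIV. u $ i *\<^sub>R axis i 1) (\<Sum>j\<in>UNIV. v $ j *\<^sub>R axis j 1)"
    using basis_expansion[of u] basis_expansion[of v] by (simp add: scalar_mult_eq_scaleR)
  also have "\<dots> = (\<Sum>i\<in>UNIV. \<Sum>j\<in>UNIV. u $ i * (v $ j * H x (axis i 1) (axis j 1)))"
    by (simp add: linear_sum[OF linear_H(1)[OF x]] linear_sum[OF linear_H(2)[OF x]] H_lmul[OF x] H_rmul[OF x]
        sum_distrib_left) (subst sum.swap, simp add: mult.left_commute)
  also have "\<dots> = u \<bullet> (gram_matrix H x *v v)"
    by (simp add: inner_vec_def matrix_vector_mult_def gram_matrix_def sum_distrib_left mult.commute)
  finally show ?thesis .
qed

lemma invertible_gram: "x \<in> T \<Longrightarrow> invertible (gram_matrix H x)"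
proof -
  assume x: "x \<in> T"
  have "v = 0" if "gram_matrix H x *v v = 0" for v
    using H_pos[OF x, of v] H_gram[OF x, of v v] that by force
  then show ?thesis
    by (simp add: invertible_left_inverse matrix_left_invertible_ker)
qed

lemma smooth_gram: "smooth_on T (\<lambda>x. gram_matrix H x $ i $ j)"
  by (simp add: gram_matrix_def smooth_H)

lemma smooth_matrix_inv_gram: "smooth_on T (\<lambda>x. matrix_inv (gram_matrix H x) $ k $ l)"
proof (rule smooth_on_cong[OF open_T])
  have *: "smooth_on T (\<lambda>x. (\<chi> i j. if j = k then axis l 1 $ i else gram_matrix H x $ i $ j) $ i $ j)" for i j
    by (cases "j = k") (simp_all add: smooth_on_const smooth_gram)
  show "smooth_on T (\<lambda>x. det (\<chi> i j. if j = k then axis l 1 $ i else gram_matrix H x $ i $ j)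
      * inverse (det (gram_matrix H x)))"
    using invertible_gram
    by (intro smooth_on_mult[OF open_T] smooth_on_inverse[OF open_T] smooth_on_det[OF open_T] smooth_gram *)
      (simp add: invertible_det_nz)
qed (simp add: matrix_inv_cramer[OF invertible_gram] divide_inverse)

lemma smooth_\<Gamma>: "smooth_on T (\<lambda>x. \<Gamma> x u v)"
proof -
  have p: "smooth_on T (\<lambda>x. metric_partial H x i j l)" for i j l
    unfolding metric_partial_def by (intro smooth_on_D smooth_gram)
  have c: "smooth_on T (\<lambda>x. christoffel H x k i j)" for k i j
    unfolding christoffel_def divide_inverse
    by (intro smooth_on_mult[OF open_T] smooth_on_sum[OF open_T] smooth_on_add[OF open_T]
        smooth_on_diff[OF open_T] smooth_matrix_inv_gram p smooth_on_const)
  show ?thesis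
    unfolding christoffel_form_def
    by (intro smooth_on_vec_lambda[OF open_T] smooth_on_mult[OF open_T] smooth_on_sum[OF open_T] c smooth_on_const)
qed

lemma bilinear_\<Gamma>: "bilinear (\<Gamma> x)"
  unfolding bilinear_def christoffel_form_def
  by (auto intro!: linearI simp: vec_eq_iff algebra_simps sum.distrib sum_distrib_left)

lemmas \<Gamma>_ladd = bilinear_ladd[OF bilinear_\<Gamma>] and \<Gamma>_radd = bilinear_radd[OF bilinear_\<Gamma>]
  and \<Gamma>_lsub = bilinear_lsub[OF bilinear_\<Gamma>] and \<Gamma>_rsub = bilinear_rsub[OF bilinear_\<Gamma>]
  and \<Gamma>_lmul = bilinear_lmul[OF bilinear_\<Gamma>] and \<Gamma>_rmul = bilinear_rmul[OF bilinear_\<Gamma>]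
  and \<Gamma>_lzero = bilinear_lzero[OF bilinear_\<Gamma>]

lemma metric_partial_sym: "x \<in> T \<Longrightarrow> metric_partial H x i j l = metric_partial H x i l j"
  unfolding metric_partial_def
  by (subst D_cong_open[OF open_T, where g = "\<lambda>y. gram_matrix H y $ l $ j"]) (auto simp: gram_matrix_def H_sym)

lemma \<Gamma>_sym: "x \<in> T \<Longrightarrow> \<Gamma> x u v = \<Gamma> x v u"
proof -
  assume x: "x \<in> T"
  have c: "christoffel H x k i j = christoffel H x k j i" for k i j
    unfolding christoffel_def using metric_partial_sym[OF x]
    by (intro arg_cong2[where f = "(/)"] sum.cong refl) (simp add: add.commute)
  show ?thesis unfolding christoffel_form_def
    by (subst sum.swap, subst c) (simp add: mult_ac)
qed

definition dH :: "real ^ 'n \<Rightarrow> real ^ 'n \<Rightarrow> real ^ 'n \<Rightarrow> real ^ 'n \<Rightarrow> real" where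
  "dH x w u v = D (\<lambda>y. H y u v) x w"

lemma diff_H: "x \<in> T \<Longrightarrow> (\<lambda>y. H y u v) differentiable (at x)"
  by (rule smooth_on_differentiable[OF smooth_H open_T])

lemma diff_\<Gamma>: "x \<in> T \<Longrightarrow> (\<lambda>y. \<Gamma> y u v) differentiable (at x)"
  by (rule smooth_on_differentiable[OF smooth_\<Gamma> open_T])

lemma dH_bilinear: "x \<in> T \<Longrightarrow> bilinear (\<lambda>u v. dH x w u v)"
  unfolding dH_def by (rule bilinear_D_family[OF open_T _ bilinear_H diff_H])

lemma dH_linear: "x \<in> T \<Longrightarrow> linear (\<lambda>w. dH x w u v)"
  unfolding dH_def by (rule linear_frechet_derivative[OF diff_H])

lemma dH_sym: "x \<in> T \<Longrightarrow> dH x w u v = dH x w v u"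
  unfolding dH_def by (subst D_cong_open[OF open_T, where g = "\<lambda>y. H y v u"]) (auto simp: H_sym)

text \<open>Multiplying the definition of the Christoffel symbols by the Gram matrix cancels its inverse;
  what remains is the Koszul formula on coordinate vectors, and it extends by linearity.\<close>

lemma koszul:
  assumes x: "x \<in> T"
  shows "2 * H x (\<Gamma> x u v) w = dH x u v w + dH x v u w - dH x w u v"
proof -
  let ?I = "matrix_inv (gram_matrix H x)" and ?p = "metric_partial H x"
  have p: "?p i j l = dH x (axis i 1) (axis j 1) (axis l 1)" for i j l
    by (simp add: metric_partial_def dH_def gram_matrix_def)
  have lin: "linear (\<lambda>w. dH x w u v)" "linear (dH x w u)" "linear (\<lambda>u. dH x w u v)" for u v w
    using dH_linear[OF x] dH_bilinear[OF x] by (auto simp: bilinear_def)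
  let ?a = "\<chi> l. (dH x u v (axis l 1) + dH x v u (axis l 1) - dH x (axis l 1) u v) / 2"
  have e1: "dH x a b (axis l 1) = (\<Sum>i\<in>UNIV. \<Sum>j\<in>UNIV. ?p i j l * a $ i * b $ j)" for a b l
    unfolding p
    by (subst linear_axis_sum[OF lin(1)], subst linear_axis_sum[OF lin(3)])
      (simp add: sum_distrib_left mult_ac)
  have e2: "dH x (axis l 1) a b = (\<Sum>i\<in>UNIV. \<Sum>j\<in>UNIV. ?p l i j * a $ i * b $ j)" for a b l
    unfolding p
    by (subst linear_axis_sum[OF lin(3)], subst linear_axis_sum[OF lin(2)])
      (simp add: sum_distrib_left mult_ac)
  have a: "?a $ l = (\<Sum>i\<in>UNIV. \<Sum>j\<in>UNIV. (?p i j l + ?p j i l - ?p l i j) / 2 * u $ i * v $ j)" for l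
  proof -
    have "dH x v u (axis l 1) = (\<Sum>i\<in>UNIV. \<Sum>j\<in>UNIV. ?p j i l * u $ i * v $ j)"
      unfolding e1 by (subst sum.swap) (simp add: mult_ac)
    then show ?thesis
      by (simp add: e1[of u v] e2 sum.distrib sum_subtractf algebra_simps sum_divide_distrib add_divide_distrib diff_divide_distrib)
  qed
  have "\<Gamma> x u v = ?I *v ?a"
  proof (rule vec_eq_iff[THEN iffD2, rule_format])
    fix k
    have "(?I *v ?a) $ k = (\<Sum>l\<in>UNIV. \<Sum>i\<in>UNIV. \<Sum>j\<in>UNIV. ?I $ k $ l * ((?p i j l + ?p j i l - ?p l i j) / 2 * u $ i * v $ j))"
      by (simp only: matrix_vector_mult_def vec_lambda_beta[of _ k] a sum_distrib_left)
    also have "\<dots> = (\<Sum>i\<in>UNIV. \<Sum>j\<in>UNIV. \<Sum>l\<in>UNIV. ?I $ k $ l * ((?p i j l + ?p j i l - ?p l i j) / 2 * u $ i * v $ j))"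
      by (subst sum.swap, rule sum.cong[OF refl], rule sum.swap)
    also have "\<dots> = \<Gamma> x u v $ k"
      by (simp add: christoffel_form_def christoffel_def sum_distrib_left sum_distrib_right sum_divide_distrib mult_ac)
    finally show "\<Gamma> x u v $ k = (?I *v ?a) $ k" by simp
  qed
  then have "gram_matrix H x *v \<Gamma> x u v = ?a"
    by (simp add: matrix_vector_mul_assoc matrix_inv_right[OF invertible_gram[OF x]])
  then have "H x w (\<Gamma> x u v) = w \<bullet> ?a" by (simp add: H_gram[OF x])
  also have "\<dots> = (\<Sum>l\<in>UNIV. w $ l * dH x u v (axis l 1) + w $ l * dH x v u (axis l 1) - w $ l * dH x (axis l 1) u v) / 2"
    by (simp add: inner_vec_def algebra_simps sum_divide_distrib)
  also have "\<dots> = (dH x u v w + dH x v u w - dH x w u v) / 2"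
    by (simp only: sum.distrib sum_subtractf linear_axis_sum[OF lin(2), of _ _ w] linear_axis_sum[OF lin(1)[of u v], of w])
  finally show ?thesis by (simp add: H_sym[OF x])
qed

text \<open>Adding the Koszul formulas with the last two arguments exchanged cancels all derivatives of
  the metric except the one in direction \<open>w\<close>.\<close>

lemma metric_compatible:
  assumes x: "x \<in> T"
  shows "D (\<lambda>y. H y u v) x w = H x (\<Gamma> x w u) v + H x u (\<Gamma> x w v)"
  using koszul[OF x, of w u v] koszul[OF x, of w v u] dH_sym[OF x, of w u v] dH_sym[OF x, of u w v]
    dH_sym[OF x, of v w u] H_sym[OF x, of u "\<Gamma> x w v"]
  unfolding dH_def[symmetric] by simp

end

section \<open>Vector fields along a map and the curvature tensor\<close>

text \<open>A map between coordinate domains, with a metric on the target only: this is all the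
  pull-back connection depends on.\<close>

locale map_domain = riemannian_domain T H for T :: "(real ^ 'n::finite) set" and H +
  fixes S :: "(real ^ 'm::finite) set" and f :: "('m, 'n) along"
  assumes open_S: "open S" and smooth_f: "smooth_on S f" and fS: "f ` S \<subseteq> T"
begin

abbreviation pb :: "'m vfield \<Rightarrow> ('m, 'n) along \<Rightarrow> ('m, 'n) along" where
  "pb \<equiv> pullback_conn H f"

lemma f_in: "x \<in> S \<Longrightarrow> f x \<in> T" using fS by auto

lemmas diff_S = smooth_on_differentiable[OF _ open_S]

lemma linear_Df: "x \<in> S \<Longrightarrow> linear (D f x)"
  by (rule linear_frechet_derivative[OF diff_S[OF smooth_f]])

lemma smooth_dmap: "smooth_on S X \<Longrightarrow> smooth_on S (dmap f X)"
  unfolding dmap_def by (rule smooth_on_D_field[OF open_S smooth_f])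

lemma smooth_\<Gamma>_along:
  assumes "smooth_on S U" "smooth_on S V"
  shows "smooth_on S (\<lambda>y. \<Gamma> (f y) (U y) (V y))"
proof (rule smooth_on_bilinear_family[OF open_S, where B = "\<lambda>y. \<Gamma> (f y)"])
  show "smooth_on S (\<lambda>y. \<Gamma> (f y) a b)" for a b
    by (rule smooth_on_compose[OF open_S open_T fS smooth_f smooth_\<Gamma>])
qed (rule bilinear_\<Gamma> assms)+

lemma smooth_pb: "smooth_on S X \<Longrightarrow> smooth_on S V \<Longrightarrow> smooth_on S (pb X V)"
  unfolding pullback_conn_def
  by (rule smooth_on_add[OF open_S smooth_on_D_field[OF open_S] smooth_\<Gamma>_along[OF smooth_dmap]])

lemma pb_cong: "x \<in> S \<Longrightarrow> (\<And>y. y \<in> S \<Longrightarrow> V y = W y) \<Longrightarrow> pb X V x = pb X W x"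
  unfolding pullback_conn_def using D_cong_open[OF open_S, of x V W] by simp

lemma pb_diff:
  "x \<in> S \<Longrightarrow> smooth_on S V \<Longrightarrow> smooth_on S W \<Longrightarrow> pb X (\<lambda>y. V y - W y) x = pb X V x - pb X W x"
  unfolding pullback_conn_def by (simp add: D_diff diff_S \<Gamma>_rsub)

lemma pb_sum:
  assumes "x \<in> S" "\<And>i. i \<in> I \<Longrightarrow> smooth_on S (V i)"
  shows "pb X (\<lambda>y. \<Sum>i\<in>I. V i y) x = (\<Sum>i\<in>I. pb X (V i) x)"
proof -
  have "((\<lambda>y. \<Sum>i\<in>I. V i y) has_derivative (\<lambda>v. \<Sum>i\<in>I. D (V i) x v)) (at x)"
    by (intro has_derivative_sum has_D diff_S assms)
  moreover have "linear (\<Gamma> (f x) u)" for u using bilinear_\<Gamma> by (simp add: bilinear_def)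
  ultimately show ?thesis
    unfolding pullback_conn_def by (simp add: D_eqI linear_sum sum.distrib)
qed

lemma pb_vfield_diff:
  assumes "x \<in> S" "smooth_on S V" "Z x = X x - Y x"
  shows "pb Z V x = pb X V x - pb Y V x"
  using assms linear_frechet_derivative[OF diff_S[OF assms(2,1)]] linear_Df[OF assms(1)]
  unfolding pullback_conn_def dmap_def by (simp add: linear_diff \<Gamma>_lsub)

lemma D_dmap:
  "x \<in> S \<Longrightarrow> Y differentiable (at x) \<Longrightarrow> D (dmap f Y) x v = D (\<lambda>y. D f y (Y x)) x v + D f x (D Y x v)"
  unfolding dmap_def by (rule D_field[OF open_S _ smooth_f])

lemma D2f_sym: "x \<in> S \<Longrightarrow> D (\<lambda>y. D f y u) x v = D (\<lambda>y. D f y v) x u"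
  by (rule second_derivative_symmetric[OF open_S _ smooth_f])

text \<open>In coordinates only the symmetric second derivative of \<open>f\<close> and the symmetric Christoffel form
  survive besides the bracket.\<close>

lemma pb_torsion_free:
  assumes "x \<in> S" "smooth_on S X" "smooth_on S Y"
  shows "pb X (dmap f Y) x - pb Y (dmap f X) x = dmap f (lie_bracket X Y) x"
  unfolding pullback_conn_def lie_bracket_def
  using assms D2f_sym[OF assms(1), of "X x" "Y x"] \<Gamma>_sym[OF f_in[OF assms(1)], of "dmap f X x" "dmap f Y x"]
  by (simp add: D_dmap diff_S linear_diff[OF linear_Df[OF assms(1)]] dmap_def[of f "\<lambda>x. _ x - _ x"])

lemma pb_metric:
  assumes x: "x \<in> S" and V: "smooth_on S V" and W: "smooth_on S W"
  shows "D (\<lambda>y. H (f y) (V y) (W y)) x (X x) = H (f x) (pb X V x) (W x) + H (f x) (V x) (pb X W x)"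
proof -
  have c: "(\<lambda>y. H (f y) a b) differentiable (at x)" for a b
    using smooth_on_compose[OF open_S open_T fS smooth_f smooth_H] x diff_S by blast
  have "D (\<lambda>y. H (f y) (V y) (W y)) x (X x) = D (\<lambda>y. H (f y) (V x) (W x)) x (X x)
      + H (f x) (D V x (X x)) (W x) + H (f x) (V x) (D W x (X x))"
    by (rule D_bilinear_family[OF open_S x _ c diff_S[OF V x] diff_S[OF W x]]) (rule bilinear_H[OF f_in])
  also have "D (\<lambda>y. H (f y) (V x) (W x)) x (X x) = D (\<lambda>z. H z (V x) (W x)) (f x) (D f x (X x))"
    by (rule D_compose[OF diff_S[OF smooth_f x] diff_H[OF f_in[OF x]]])
  finally show ?thesis
    by (simp add: metric_compatible[OF f_in[OF x]] pullback_conn_def dmap_def H_ladd[OF f_in[OF x]] H_radd[OF f_in[OF x]])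
qed

end

context riemannian_domain begin

text \<open>Facts about the pull-back connection along the identity are facts about the Levi-Civita
  connection.\<close>

lemma identity_map: "map_domain T H T (\<lambda>x. x)"
  by unfold_locales (auto intro: open_T smooth_on_ident)

lemma levi_civita_pullback: "levi_civita H = pullback_conn H (\<lambda>x. x)"
  by (simp add: fun_eq_iff levi_civita_def pullback_conn_def dmap_def)

abbreviation R :: "real ^ 'n \<Rightarrow> real ^ 'n \<Rightarrow> real ^ 'n \<Rightarrow> real ^ 'n \<Rightarrow> real ^ 'n" where
  "R \<equiv> curvature_at H"

lemma R_eq:
  "R x u v w = D (\<lambda>z. \<Gamma> z v w) x u - D (\<lambda>z. \<Gamma> z u w) x v + \<Gamma> x u (\<Gamma> x v w) - \<Gamma> x v (\<Gamma> x u w)"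
  by (simp add: curvature_at_def curvature_def levi_civita_def lie_bracket_def \<Gamma>_lzero)

end

context map_domain begin

lemma D_pb:
  assumes x: "x \<in> S" and Y: "smooth_on S Y" and V: "smooth_on S V"
  shows "D (pb Y V) x v = D (\<lambda>y. D V y (Y x)) x v + D V x (D Y x v)
    + D (\<lambda>z. \<Gamma> z (D f x (Y x)) (V x)) (f x) (D f x v)
    + \<Gamma> (f x) (D (\<lambda>y. D f y (Y x)) x v + D f x (D Y x v)) (V x) + \<Gamma> (f x) (D f x (Y x)) (D V x v)"
proof -
  have s: "smooth_on S (\<lambda>y. \<Gamma> (f y) a b)" for a b
    by (rule smooth_on_compose[OF open_S open_T fS smooth_f smooth_\<Gamma>])
  have "D (pb Y V) x v = D (\<lambda>y. D V y (Y y)) x v + D (\<lambda>y. \<Gamma> (f y) (dmap f Y y) (V y)) x v"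
    unfolding pullback_conn_def
    by (rule D_add[OF diff_S[OF smooth_on_D_field[OF open_S V Y] x] diff_S[OF smooth_\<Gamma>_along[OF smooth_dmap[OF Y] V] x]])
  also have "D (\<lambda>y. \<Gamma> (f y) (dmap f Y y) (V y)) x v = D (\<lambda>y. \<Gamma> (f y) (dmap f Y x) (V x)) x v
      + \<Gamma> (f x) (D (dmap f Y) x v) (V x) + \<Gamma> (f x) (dmap f Y x) (D V x v)"
    by (rule D_bilinear_family[OF open_S x bilinear_\<Gamma> diff_S[OF s x] diff_S[OF smooth_dmap[OF Y] x] diff_S[OF V x]])
  also have "D (\<lambda>y. \<Gamma> (f y) (dmap f Y x) (V x)) x v = D (\<lambda>z. \<Gamma> z (dmap f Y x) (V x)) (f x) (D f x v)"
    by (rule D_compose[OF diff_S[OF smooth_f x] diff_\<Gamma>[OF f_in[OF x]]])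
  finally show ?thesis
    by (simp add: D_field[OF open_S x V diff_S[OF Y x]] D_dmap[OF x diff_S[OF Y x]]) (simp add: dmap_def)
qed

text \<open>The curvature of the pull-back connection is the pulled-back curvature of the target: the
  terms symmetric in \<open>X\<close> and \<open>Y\<close> cancel, among them the second derivatives of \<open>V\<close> and \<open>f\<close>, the
  derivatives of \<open>X\<close> and \<open>Y\<close> are absorbed by the bracket term, and what remains involves only \<open>\<Gamma>\<close>
  and its derivative.\<close>

lemma pb_curvature:
  assumes x: "x \<in> S" and X: "smooth_on S X" and Y: "smooth_on S Y" and V: "smooth_on S V"
  shows "pb X (pb Y V) x - pb Y (pb X V) x - pb (lie_bracket X Y) V x
    = R (f x) (dmap f X x) (dmap f Y x) (V x)"
proof -
  have sym: "D (\<lambda>y. D V y (Y x)) x (X x) = D (\<lambda>y. D V y (X x)) x (Y x)"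
    by (rule second_derivative_symmetric[OF open_S x V])
  have e: "pb A (pb B V) x = D (pb B V) x (A x) + \<Gamma> (f x) (D f x (A x)) (D V x (B x) + \<Gamma> (f x) (D f x (B x)) (V x))" for A B
    by (simp add: pullback_conn_def dmap_def)
  have l: "pb (lie_bracket X Y) V x = D V x (D Y x (X x)) - D V x (D X x (Y x))
      + \<Gamma> (f x) (D f x (D Y x (X x)) - D f x (D X x (Y x))) (V x)"
    using linear_frechet_derivative[OF diff_S[OF V x]] linear_Df[OF x]
    by (simp add: pullback_conn_def lie_bracket_def dmap_def linear_diff)
  show ?thesis
    unfolding e l D_pb[OF x X V] D_pb[OF x Y V] R_eq dmap_def
    using sym D2f_sym[OF x, of "X x" "Y x"]
    by (simp add: \<Gamma>_ladd \<Gamma>_radd \<Gamma>_lsub algebra_simps)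
qed

end

context riemannian_domain begin

lemma smooth_levi_civita: "smooth_on T X \<Longrightarrow> smooth_on T Y \<Longrightarrow> smooth_on T (levi_civita H X Y)"
  unfolding levi_civita_pullback by (rule map_domain.smooth_pb[OF identity_map])

lemma levi_civita_torsion_free:
  "x \<in> T \<Longrightarrow> smooth_on T X \<Longrightarrow> smooth_on T Y \<Longrightarrow> levi_civita H X Y x - levi_civita H Y X x = lie_bracket X Y x"
  unfolding levi_civita_pullback using map_domain.pb_torsion_free[OF identity_map, of x X Y]
  by (simp add: dmap_def)

lemma levi_civita_metric:
  "x \<in> T \<Longrightarrow> smooth_on T V \<Longrightarrow> smooth_on T W \<Longrightarrow>
   D (\<lambda>y. H y (V y) (W y)) x (X x) = H x (levi_civita H X V x) (W x) + H x (V x) (levi_civita H X W x)"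
  unfolding levi_civita_pullback by (rule map_domain.pb_metric[OF identity_map])

lemma smooth_lie_bracket: "smooth_on T X \<Longrightarrow> smooth_on T Y \<Longrightarrow> smooth_on T (lie_bracket X Y)"
  unfolding lie_bracket_def
  by (rule smooth_on_diff[OF open_T smooth_on_D_field[OF open_T] smooth_on_D_field[OF open_T]])

text \<open>For the identity map, the formula for the curvature of the pull-back connection says that the
  curvature of vector fields is determined by their values at the point.\<close>

lemma curvature_tensorial:
  "x \<in> T \<Longrightarrow> smooth_on T X \<Longrightarrow> smooth_on T Y \<Longrightarrow> smooth_on T Z \<Longrightarrow>
   curvature H X Y Z x = R x (X x) (Y x) (Z x)"
  unfolding curvature_def levi_civita_pullback
  using map_domain.pb_curvature[OF identity_map, of x X Y Z] by (simp add: dmap_def)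

text \<open>The trilinear expression is a combination of covariant derivatives of smooth fields, so the
  derivatives of the Christoffel symbols in it need not be treated one by one.\<close>

lemma smooth_R:
  assumes "smooth_on T X" "smooth_on T Y" "smooth_on T Z"
  shows "smooth_on T (\<lambda>x. R x (X x) (Y x) (Z x))"
proof (rule smooth_on_cong[OF open_T])
  show "smooth_on T (curvature H X Y Z)" unfolding curvature_def
    by (intro smooth_on_diff[OF open_T] smooth_levi_civita smooth_lie_bracket assms)
qed (simp add: curvature_tensorial assms)

lemma R_antisym: "R x u v w = - R x v u w"
  by (simp add: R_eq)

lemma D\<Gamma>_sym: "x \<in> T \<Longrightarrow> D (\<lambda>z. \<Gamma> z u v) x = D (\<lambda>z. \<Gamma> z v u) x"
  by (rule D_cong_open[OF open_T]) (auto intro: \<Gamma>_sym)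

lemma R_bianchi: "x \<in> T \<Longrightarrow> R x u v w + R x v w u + R x w u v = 0"
  using \<Gamma>_sym[of x] D\<Gamma>_sym[of x u v] D\<Gamma>_sym[of x v w] D\<Gamma>_sym[of x w u]
  by (simp add: R_eq)

lemma R_linear1: "x \<in> T \<Longrightarrow> linear (\<lambda>u. R x u v w)"
  and R_linear3: "x \<in> T \<Longrightarrow> linear (\<lambda>w. R x u v w)"
proof -
  assume x: "x \<in> T"
  define \<Gamma>' where "\<Gamma>' a b v = D (\<lambda>z. \<Gamma> z a b) x v" for a b v
  have 1: "linear (\<Gamma>' v w)" for v w
    unfolding \<Gamma>'_def by (rule linear_frechet_derivative[OF diff_\<Gamma>[OF x]])
  have 2: "bilinear (\<lambda>a b. \<Gamma>' a b v)" for v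
    unfolding \<Gamma>'_def by (rule bilinear_D_family[OF open_T x bilinear_\<Gamma> diff_\<Gamma>[OF x]])
  show "linear (\<lambda>u. R x u v w)" "linear (\<lambda>w. R x u v w)"
    unfolding R_eq \<Gamma>'_def[symmetric]
    by (auto intro!: linearI simp: linear_add[OF 1] linear_cmul[OF 1] bilinear_ladd[OF 2] bilinear_lmul[OF 2]
        bilinear_radd[OF 2] bilinear_rmul[OF 2] \<Gamma>_ladd \<Gamma>_radd \<Gamma>_lmul \<Gamma>_rmul algebra_simps)
qed

text \<open>By metric compatibility, exchanging the directions \<open>u\<close> and \<open>v\<close> in the second derivative of
  \<open>H(w,w)\<close> changes it by twice the left-hand side, and second derivatives are symmetric.\<close>

lemma R_skew:
  assumes x: "x \<in> T"
  shows "H x (R x u v w) w = 0"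
proof -
  have d: "D (\<lambda>y. D (\<lambda>z. H z w w) y b) x a
     = 2 * (H x (\<Gamma> x a (\<Gamma> x b w)) w + H x (\<Gamma> x b w) (\<Gamma> x a w) + H x (D (\<lambda>z. \<Gamma> z b w) x a) w)" for a b
  proof -
    have s: "smooth_on T (\<lambda>y. H y (\<Gamma> y b w) w)"
      by (rule smooth_on_bilinear_family[OF open_T bilinear_H smooth_H smooth_\<Gamma> smooth_on_const])
    have "D (\<lambda>y. D (\<lambda>z. H z w w) y b) x a = D (\<lambda>y. H y (\<Gamma> y b w) w + H y (\<Gamma> y b w) w) x a"
      by (subst D_cong_open[OF open_T x, where g = "\<lambda>y. H y (\<Gamma> y b w) w + H y (\<Gamma> y b w) w"])
        (auto simp: metric_compatible H_sym)
    also have "\<dots> = 2 * D (\<lambda>y. H y (\<Gamma> y b w) w) x a"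
      using D_add[OF smooth_on_differentiable[OF s open_T x] smooth_on_differentiable[OF s open_T x]] by simp
    also have "D (\<lambda>y. H y (\<Gamma> y b w) w) x a = D (\<lambda>y. H y (\<Gamma> x b w) w) x a + H x (D (\<lambda>z. \<Gamma> z b w) x a) w"
      using D_bilinear_family[OF open_T x bilinear_H diff_H[OF x] diff_\<Gamma>[OF x] differentiable_const, where v = a, of b w w]
      by (simp add: H_rzero[OF x])
    finally show ?thesis by (simp add: metric_compatible[OF x])
  qed
  have "D (\<lambda>y. D (\<lambda>z. H z w w) y v) x u = D (\<lambda>y. D (\<lambda>z. H z w w) y u) x v"
    by (rule second_derivative_symmetric[OF open_T x smooth_H])
  then show ?thesis
    unfolding d R_eq using H_sym[OF x, of "\<Gamma> x u w" "\<Gamma> x v w"] by (simp add: H_ladd[OF x] H_lsub[OF x])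
qed

lemma R_skew2:
  assumes x: "x \<in> T"
  shows "H x (R x u v w) z = - H x (R x u v z) w"
  using R_skew[OF x, of u v "w + z"] R_skew[OF x, of u v w] R_skew[OF x, of u v z]
  by (simp add: linear_add[OF R_linear3[OF x]] H_ladd[OF x] H_radd[OF x])

end

text \<open>A tensor with the symmetries of a curvature tensor is determined by its sectional
  curvatures. Polarising first in \<open>v\<close> and then in \<open>u\<close> makes \<open>F\<close> skew in all three of its first
  arguments, and then the Bianchi identity says that three times \<open>F\<close> is zero.\<close>

lemma curvature_like_vanishes:
  fixes F :: "'a::ab_group_add \<Rightarrow> 'a \<Rightarrow> 'a \<Rightarrow> 'a \<Rightarrow> real"
  assumes add1: "\<And>u u' v w z. F (u + u') v w z = F u v w z + F u' v w z"
    and add3: "\<And>u v w w' z. F u v (w + w') z = F u v w z + F u v w' z"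
    and anti: "\<And>u v w z. F u v w z = - F v u w z" and skew: "\<And>u v w z. F u v w z = - F u v z w"
    and bianchi: "\<And>u v w z. F u v w z + F v w u z + F w u v z = 0"
    and sec: "\<And>u v. F u v v u = 0"
  shows "F u v w z = 0"
proof -
  \<comment> \<open>Bianchi identities that fix one of the four arguments in turn, added up with suitable signs.\<close>
  have pair: "F u v w z = F w z u v" for u v w z
    using bianchi[of u v w z] bianchi[of v w z u] bianchi[of w z u v] bianchi[of z u v w]
      skew[of v w u z] anti[of w u v z] skew[of u w v z] skew[of w z u v] skew[of w z v u] skew[of z v w u]
      anti[of u v w z] skew[of u v w z] anti[of z u v w] skew[of u z v w] anti[of v z w u]
      skew[of v z w u] skew[of u z w v] anti[of u z w v] skew[of z u w v] anti[of w z u v]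
      anti[of v w z u] anti[of w z v u] skew[of z w u v] anti[of u w z v] skew[of w u z v] skew[of v w z u]
    by linarith
  have add2: "F u (v + v') w z = F u v w z + F u v' w z" for u v v' w z
    using add1[of v v' u w z] anti[of u "v + v'" w z] anti[of u v w z] anti[of u v' w z] by simp
  have add4: "F u v w (z + z') = F u v w z + F u v w z'" for u v w z z'
    using add3[of u v z z' w] skew[of u v w "z + z'"] skew[of u v w z] skew[of u v w z'] by simp
  have s1: "F u v w u = 0" for u v w
    using sec[of u "v + w"] sec[of u v] sec[of u w] pair[of u v w u] anti[of w u u v] skew[of u w u v]
    by (simp add: add2 add3)
  have s2: "F u v w z = - F z v w u" for u v w z
    using s1[of "u + z" v w] s1[of u v w] s1[of z v w] by (simp add: add1 add4)
  have s3: "F u v w z = - F u w v z" for u v w z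
    using s2[of u v w z] pair[of z v w u] anti[of w u z v] skew[of u w z v] by linarith
  show ?thesis
    using bianchi[of u v w z] s3[of u v w z] anti[of u w v z] s3[of w u v z] anti[of w v u z] anti[of v w u z] by linarith
qed

context riemannian_domain begin

text \<open>The difference of the two sides has the symmetries of a curvature tensor and vanishing
  sectional curvatures. Dependent pairs of vectors, on which the sectional curvature says nothing,
  are covered by skewness.\<close>

lemma constant_curvature:
  assumes x: "x \<in> T"
    and sec: "\<And>u v. u \<noteq> v \<and> independent {u, v} \<Longrightarrow> sectional_curvature H x u v = \<kappa>"
  shows "R x u v w = \<kappa> *\<^sub>R (H x v w *\<^sub>R u - H x u w *\<^sub>R v)"
proof (rule H_eqI[OF x])
  fix z
  define F where "F u v w z = H x (R x u v w) z - \<kappa> * (H x v w * H x u z - H x u w * H x v z)" for u v w z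
  have "F u v w z = 0"
  proof (rule curvature_like_vanishes[of F])
    fix u u' v w w' z
    show "F (u + u') v w z = F u v w z + F u' v w z"
      by (simp add: F_def linear_add[OF R_linear1[OF x]] H_ladd[OF x] algebra_simps)
    show "F u v (w + w') z = F u v w z + F u v w' z"
      by (simp add: F_def linear_add[OF R_linear3[OF x]] H_ladd[OF x] H_radd[OF x] algebra_simps)
    show "F u v w z = - F v u w z"
      using R_antisym[of x u v w] by (simp add: F_def H_lneg[OF x] algebra_simps)
    show "F u v w z = - F u v z w"
      using R_skew2[OF x, of u v w z] by (simp add: F_def algebra_simps)
    have "H x (R x u v w + R x v w u + R x w u v) z = 0" by (simp only: R_bianchi[OF x] H_lzero[OF x])
    then show "F u v w z + F v w u z + F w u v z = 0"
      by (simp add: F_def H_ladd[OF x] H_sym[OF x, of v u] H_sym[OF x, of w u] H_sym[OF x, of w v] algebra_simps)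
  next
    fix u v
    have Rvv: "R x v v w = 0" for v w by (simp add: R_eq)
    show "F u v v u = 0"
    proof (cases "u \<noteq> v \<and> independent {u, v}")
      case True
      have "v \<noteq> 0" using True by (auto simp: dependent_zero)
      have "u \<notin> span {v}" using True by (simp add: independent_insert)
      \<comment> \<open>The denominator of the sectional curvature is nonzero by the strict Cauchy-Schwarz inequality: it is \<open>H(w,w) / H(v,v)\<close> for the multiple \<open>w\<close> of the part of \<open>u\<close> orthogonal to \<open>v\<close>.\<close>
      let ?w = "H x v v *\<^sub>R u - H x u v *\<^sub>R v"
      have "H x v v > 0" using H_pos[OF x \<open>v \<noteq> 0\<close>] .
      have "?w \<noteq> 0"
      proof
        assume "?w = 0"
        then have "(1 / H x v v) *\<^sub>R (H x v v *\<^sub>R u) = (1 / H x v v) *\<^sub>R (H x u v *\<^sub>R v)" by simp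
        then have "u = (H x u v / H x v v) *\<^sub>R v" using \<open>H x v v > 0\<close> by simp
        then show False using \<open>u \<notin> span {v}\<close> by (metis span_base span_scale singletonI)
      qed
      then have "H x ?w ?w > 0" by (rule H_pos[OF x])
      also have "H x ?w ?w = H x v v * (H x u u * H x v v - (H x u v)\<^sup>2)"
        using H_sym[OF x, of v u]
        by (simp add: H_lsub[OF x] H_rsub[OF x] H_lmul[OF x] H_rmul[OF x] algebra_simps power2_eq_square)
      finally have "H x u u * H x v v - (H x u v)\<^sup>2 \<noteq> 0" by auto
      then have "H x (R x u v v) u = \<kappa> * (H x u u * H x v v - (H x u v)\<^sup>2)"
        using sec[OF True] by (simp add: sectional_curvature_def field_simps)
      then show ?thesis using H_sym[OF x, of v u] by (simp add: F_def algebra_simps power2_eq_square)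
    next
      case False
      then have "u \<in> span {v} \<or> v = 0" by (auto simp: independent_insert span_base dependent_single split: if_splits)
      then consider c where "u = c *\<^sub>R v" | "v = 0" by (auto simp: span_singleton)
      then show ?thesis
      proof cases
        case 1
        then show ?thesis
          by (simp add: F_def linear_cmul[OF R_linear1[OF x]] Rvv H_lzero[OF x] H_lmul[OF x] H_rmul[OF x] )
      next
        case 2
        then show ?thesis
          by (simp add: F_def linear_0[OF R_linear3[OF x]] H_lzero[OF x] H_rzero[OF x])
      qed
    qed
  qed
  then show "H x (R x u v w) z = H x (\<kappa> *\<^sub>R (H x v w *\<^sub>R u - H x u w *\<^sub>R v)) z"
    by (simp add: F_def H_lmul[OF x] H_lsub[OF x])
qed

end

section \<open>Isometric immersions into spaces of constant curvature\<close>

locale isometric_map =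
  M: riemannian_domain S G + map_domain T H S f
  for T :: "(real ^ 'n::finite) set" and H :: "'n local_metric"
    and S :: "(real ^ 'm::finite) set" and G :: "'m local_metric" and f :: "('m, 'n) along" +
  assumes isometry: "x \<in> S \<Longrightarrow> H (f x) (D f x u) (D f x v) = G x u v"
begin

lemma Df_injective: "x \<in> S \<Longrightarrow> D f x u = 0 \<Longrightarrow> u = 0"
  using isometry[of x u u] M.H_pos[of x u] H_lzero[OF f_in] by force

text \<open>The coordinate expression of the second fundamental form as a bilinear form on tangent
  vectors; it makes evident that the form is tensorial and symmetric.\<close>

definition II :: "real ^ 'm \<Rightarrow> real ^ 'm \<Rightarrow> real ^ 'm \<Rightarrow> real ^ 'n" where
  "II x u v = D (\<lambda>y. D f y v) x u + \<Gamma> (f x) (D f x u) (D f x v) - D f x (M.\<Gamma> x u v)"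

lemma nabla_d_II:
  assumes "x \<in> S" "smooth_on S Y"
  shows "nabla_d G H f X Y x = II x (X x) (Y x)"
proof -
  have "D (dmap f Y) x (X x) = D (\<lambda>y. D f y (Y x)) x (X x) + D f x (D Y x (X x))"
    by (rule D_dmap[OF assms(1) diff_S[OF assms(2,1)]])
  then show ?thesis
    by (simp add: nabla_d_def pullback_conn_def levi_civita_def II_def linear_add[OF linear_Df[OF assms(1)]] dmap_def)
qed

lemma II_sym: "x \<in> S \<Longrightarrow> II x u v = II x v u"
  unfolding II_def using D2f_sym[of x u v] \<Gamma>_sym[OF f_in, of x] M.\<Gamma>_sym[of x u v] by simp

lemma linear_II: "x \<in> S \<Longrightarrow> linear (\<lambda>u. II x u v)"
proof -
  assume x: "x \<in> S"
  have 1: "linear (D (\<lambda>y. D f y v) x)"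
    by (rule linear_frechet_derivative[OF diff_S[OF smooth_on_D[OF smooth_f] x]])
  show ?thesis unfolding II_def
    by (auto intro!: linearI simp: linear_add[OF 1] linear_cmul[OF 1] linear_add[OF linear_Df[OF x]]
      linear_cmul[OF linear_Df[OF x]] \<Gamma>_ladd \<Gamma>_lmul M.\<Gamma>_ladd M.\<Gamma>_lmul algebra_simps)
qed

text \<open>Comparing the derivative of \<open>H(d\<phi> b, d\<phi> c) = G(b, c)\<close> computed on both sides shows that
  \<open>\<langle>II(a,b), d\<phi> c\<rangle>\<close> is skew in \<open>b\<close> and \<open>c\<close>. It is also symmetric in \<open>a\<close> and \<open>b\<close>, and a trilinear
  form with both symmetries is zero.\<close>

lemma II_normal:
  assumes x: "x \<in> S"
  shows "H (f x) (II x u v) (D f x w) = 0"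
proof -
  have skew: "H (f x) (II x a b) (D f x c) = - H (f x) (II x a c) (D f x b)" for a b c
  proof -
    have pb: "pb (\<lambda>_. a) (dmap f (\<lambda>_. b)) x = II x a b + D f x (M.\<Gamma> x a b)" for b
      by (simp add: pullback_conn_def II_def dmap_def)
    have "D (\<lambda>y. H (f y) (dmap f (\<lambda>_. b) y) (dmap f (\<lambda>_. c) y)) x a
        = H (f x) (II x a b + D f x (M.\<Gamma> x a b)) (D f x c) + H (f x) (D f x b) (II x a c + D f x (M.\<Gamma> x a c))"
      using pb_metric[OF x smooth_dmap[OF smooth_on_const] smooth_dmap[OF smooth_on_const], of b c "\<lambda>_. a"]
      by (simp add: pb) (simp add: dmap_def)
    moreover have "D (\<lambda>y. H (f y) (dmap f (\<lambda>_. b) y) (dmap f (\<lambda>_. c) y)) x a = D (\<lambda>y. G y b c) x a"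
      by (subst D_cong_open[OF open_S x, where g = "\<lambda>y. G y b c"]) (simp_all add: dmap_def isometry)
    ultimately show ?thesis
      using f_in[OF x] H_sym[of "f x" "D f x b" "II x a c"]
      by (simp add: M.metric_compatible[OF x] H_ladd H_radd isometry[OF x])
  qed
  show ?thesis
    using skew[of u v w] skew[of w u v] skew[of v w u]
    by (simp add: II_sym[OF x, of w u] II_sym[OF x, of v w] II_sym[OF x, of v u])
qed

lemma smooth_nabla_d: "smooth_on S X \<Longrightarrow> smooth_on S Y \<Longrightarrow> smooth_on S (nabla_d G H f X Y)"
  unfolding nabla_d_def
  by (rule smooth_on_diff[OF open_S smooth_pb[OF _ smooth_dmap] smooth_dmap[OF M.smooth_levi_civita]])

lemma smooth_nabla2_d:
  assumes "smooth_on S X" "smooth_on S Y" "smooth_on S Z"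
  shows "smooth_on S (nabla2_d G H f X Y Z)"
  unfolding nabla2_d_def using assms
  by (intro smooth_on_diff[OF open_S] smooth_pb smooth_nabla_d M.smooth_levi_civita)

text \<open>Expanding \<open>\<nabla>\<^sup>2d\<phi>\<close> by its definition, the derivatives of \<open>d\<phi>(\<nabla>\<^sub>YW)\<close> along \<open>Z\<close> and of \<open>d\<phi>(\<nabla>\<^sub>ZW)\<close>
  along \<open>Y\<close> both occur symmetrically in \<open>Y\<close> and \<open>Z\<close> and cancel; the remaining
  terms form the curvatures of the two connections, the terms \<open>\<nabla>\<^sub>YZ - \<nabla>\<^sub>ZY\<close> being the bracket.\<close>

lemma ricci_identity:
  assumes x: "x \<in> S" and Y: "smooth_on S Y" and Z: "smooth_on S Z" and W: "smooth_on S W"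
  shows "nabla2_d G H f Y Z W x - nabla2_d G H f Z Y W x
    = R (f x) (D f x (Y x)) (D f x (Z x)) (D f x (W x)) - D f x (M.R x (Y x) (Z x) (W x))"
proof -
  let ?L = "levi_civita G"
  have expand: "nabla2_d G H f A B W x
      = pb A (pb B (dmap f W)) x - pb A (dmap f (?L B W)) x - (pb (?L A B) (dmap f W) x - dmap f (?L (?L A B) W) x)
        - (pb B (dmap f (?L A W)) x - dmap f (?L B (?L A W)) x)"
    if "smooth_on S A" "smooth_on S B" for A B
    using pb_diff[OF x smooth_pb[OF that(2) smooth_dmap[OF W]] smooth_dmap[OF M.smooth_levi_civita[OF that(2) W]], of A]
    by (simp add: nabla2_d_def nabla_d_def)
  have tf: "lie_bracket Y Z x = ?L Y Z x - ?L Z Y x"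
    by (simp add: M.levi_civita_torsion_free[OF x Y Z])
  have t1: "pb (lie_bracket Y Z) (dmap f W) x = pb (?L Y Z) (dmap f W) x - pb (?L Z Y) (dmap f W) x"
    by (rule pb_vfield_diff[OF x smooth_dmap[OF W]]) (rule tf)
  have t2: "?L (lie_bracket Y Z) W x = ?L (?L Y Z) W x - ?L (?L Z Y) W x"
    unfolding M.levi_civita_pullback
    by (rule map_domain.pb_vfield_diff[OF M.identity_map x W]) (simp add: tf flip: M.levi_civita_pullback)
  have "D f x (M.R x (Y x) (Z x) (W x)) = D f x (?L Y (?L Z W) x) - D f x (?L Z (?L Y W) x)
      - D f x (?L (?L Y Z) W x) + D f x (?L (?L Z Y) W x)"
    using M.curvature_tensorial[OF x Y Z W] linear_diff[OF linear_Df[OF x]]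
    by (simp add: curvature_def t2 flip: M.curvature_tensorial[OF x Y Z W])
  moreover have "R (f x) (D f x (Y x)) (D f x (Z x)) (D f x (W x))
      = pb Y (pb Z (dmap f W)) x - pb Z (pb Y (dmap f W)) x - pb (?L Y Z) (dmap f W) x + pb (?L Z Y) (dmap f W) x"
    using pb_curvature[OF x Y Z smooth_dmap[OF W]] by (simp add: t1) (simp add: dmap_def algebra_simps)
  ultimately show ?thesis
    unfolding expand[OF Y Z] expand[OF Z Y] by (simp add: dmap_def[of f "?L _ _"])
qed

text \<open>The metric is definite on the image of the differential, so an orthogonal decomposition is
  unique.\<close>

lemma tangent_part_eq:
  assumes x: "x \<in> S" and n: "\<And>w. H (f x) n (D f x w) = 0"
  shows "tangent_part H f x (D f x u + n) = D f x u"
  unfolding tangent_part_def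
proof (rule the_equality)
  show "D f x u \<in> range (D f x) \<and> (\<forall>w. H (f x) (D f x u + n - D f x u) (D f x w) = 0)"
    using n by simp
  fix w assume w: "w \<in> range (D f x) \<and> (\<forall>v. H (f x) (D f x u + n - w) (D f x v) = 0)"
  then obtain v where v: "w = D f x v" by auto
  have "H (f x) (D f x u + n - w) (D f x (u - v)) = 0" using w by blast
  then have "G x (u - v) (u - v) = 0"
    using n[of "u - v"] by (simp add: v H_ladd[OF f_in[OF x]] H_lsub[OF f_in[OF x]] isometry[OF x] M.H_lsub[OF x])
  then have "u = v" using M.H_pos[OF x, of "u - v"] by force
  then show "w = D f x u" using v by simp
qed

end

locale framed_isometric_map = isometric_map T H S G f
  for T :: "(real ^ 'n::finite) set" and H :: "'n local_metric"
    and S :: "(real ^ 'm::finite) set" and G :: "'m local_metric" and f :: "('m, 'n) along" +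
  fixes e :: "'m \<Rightarrow> 'm vfield" and \<kappa> :: real
  assumes frame: "orthonormal_frame_on S G e"
    and constant_sectional:
      "\<lbrakk>y \<in> T; u \<noteq> v \<and> independent {u, v}\<rbrakk> \<Longrightarrow> sectional_curvature H y u v = \<kappa>"
begin

lemma smooth_e: "smooth_on S (e i)"
  and e_orthonormal: "x \<in> S \<Longrightarrow> G x (e i x) (e j x) = (if i = j then 1 else 0)"
  using frame unfolding orthonormal_frame_on_def by auto

text \<open>The linear map from coefficients to combinations of the frame is injective by orthonormality,
  hence surjective because there are as many frame vectors as dimensions.\<close>

lemma frame_expansion:
  assumes x: "x \<in> S"
  shows "(\<Sum>j\<in>UNIV. G x u (e j x) *\<^sub>R e j x) = u"
proof -
  define L :: "real ^ 'm \<Rightarrow> real ^ 'm" where "L c = (\<Sum>j\<in>UNIV. c $ j *\<^sub>R e j x)" for c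
  have lin: "linear L"
    by (rule linearI) (simp_all add: L_def scaleR_add_left sum.distrib scaleR_sum_right)
  have G_L: "G x (L c) (e i x) = c $ i" for c i
    by (simp add: L_def linear_sum[OF M.linear_H(2)[OF x]] M.H_lmul[OF x] e_orthonormal[OF x] if_distrib cong: if_cong)
  have "c = 0" if "L c = 0" for c
    using G_L[of c] that by (simp add: vec_eq_iff M.H_lzero[OF x])
  then have "inj L" using linear_injective_0[OF lin] by blast
  then obtain c where "u = L c" using linear_injective_imp_surjective[OF lin] by blast
  then have "G x u (e i x) = c $ i" for i using G_L by simp
  then show ?thesis using \<open>u = L c\<close> by (simp add: L_def)
qed

text \<open>The coefficients of the vectors \<open>a j\<close> in the frame form a skew matrix, and the sum pairs it
  with a symmetric one. This is what makes traces over an orthonormal frame commute with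
  covariant differentiation.\<close>

lemma skew_frame_sum:
  fixes C :: "real ^ 'm \<Rightarrow> real ^ 'm \<Rightarrow> 'v::real_vector"
  assumes x: "x \<in> S" and skew: "\<And>j k. G x (a j) (e k x) + G x (e j x) (a k) = 0" and C: "bilinear C"
  shows "(\<Sum>j\<in>UNIV. C (a j) (e j x) + C (e j x) (a j)) = 0"
proof -
  define \<omega> where "\<omega> j k = G x (a j) (e k x)" for j k
  have sk: "\<omega> j k = - \<omega> k j" for j k
    using skew[of j k] M.H_sym[OF x, of "e j x" "a k"] by (simp add: \<omega>_def)
  have a: "a j = (\<Sum>k\<in>UNIV. \<omega> j k *\<^sub>R e k x)" for j
    using frame_expansion[OF x, of "a j"] by (simp add: \<omega>_def)
  have lin: "linear (C b)" "linear (\<lambda>b. C b b')" for b b' using C by (auto simp: bilinear_def)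
  have "(\<Sum>j\<in>UNIV. C (a j) (e j x)) = (\<Sum>j\<in>UNIV. \<Sum>k\<in>UNIV. \<omega> j k *\<^sub>R C (e k x) (e j x))"
    by (rule sum.cong[OF refl]) (subst a, simp only: linear_sum[OF lin(2)] linear_cmul[OF lin(2)])
  also have "\<dots> = (\<Sum>k\<in>UNIV. \<Sum>j\<in>UNIV. \<omega> j k *\<^sub>R C (e k x) (e j x))" by (rule sum.swap)
  also have "\<dots> = - (\<Sum>k\<in>UNIV. \<Sum>j\<in>UNIV. \<omega> k j *\<^sub>R C (e k x) (e j x))"
    by (subst sk) (simp add: sum_negf)
  also have "(\<Sum>k\<in>UNIV. \<Sum>j\<in>UNIV. \<omega> k j *\<^sub>R C (e k x) (e j x)) = (\<Sum>k\<in>UNIV. C (e k x) (a k))"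
    by (rule sum.cong[OF refl]) (subst a, simp only: linear_sum[OF lin(1)] linear_cmul[OF lin(1)])
  finally show ?thesis by (simp add: sum.distrib)
qed

lemma frame_derivative_skew:
  assumes x: "x \<in> S"
  shows "G x (levi_civita G X (e j) x) (e k x) + G x (e j x) (levi_civita G X (e k) x) = 0"
proof -
  have "D (\<lambda>y. G y (e j y) (e k y)) x = D (\<lambda>y. if j = k then 1 else 0 :: real) x"
    by (rule D_cong_open[OF open_S x]) (rule e_orthonormal)
  then show ?thesis using M.levi_civita_metric[OF x smooth_e[of j] smooth_e[of k], of X] by simp
qed

lemma R_target: "x \<in> S \<Longrightarrow> R (f x) u v w = \<kappa> *\<^sub>R (H (f x) v w *\<^sub>R u - H (f x) u w *\<^sub>R v)"
  by (rule constant_curvature[OF f_in constant_sectional[OF f_in]])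

text \<open>The curvature tensor of constant curvature \<open>\<kappa>\<close> minus that of the source. For an isometric
  immersion it is the tangent vector that \<open>d\<phi>\<close> maps to the skew part of \<open>\<nabla>\<^sup>2d\<phi>\<close>.\<close>

definition defect :: "real ^ 'm \<Rightarrow> real ^ 'm \<Rightarrow> real ^ 'm \<Rightarrow> real ^ 'm \<Rightarrow> real ^ 'm" where
  "defect x u v w = \<kappa> *\<^sub>R (G x v w *\<^sub>R u - G x u w *\<^sub>R v) - M.R x u v w"

text \<open>The trace of \<open>defect\<close> over its last two arguments, which is the endomorphism
  \<open>\<kappa>(m-1)Id - Q\<close>.\<close>

definition defect_trace :: "'m vfield \<Rightarrow> 'm vfield" where
  "defect_trace Y x = (\<kappa> * (real CARD('m) - 1)) *\<^sub>R Y x - ricci_op G e Y x"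

lemma nabla2_d_skew_part:
  assumes "x \<in> S" "smooth_on S Y" "smooth_on S Z" "smooth_on S W"
  shows "nabla2_d G H f Y Z W x - nabla2_d G H f Z Y W x = D f x (defect x (Y x) (Z x) (W x))"
  unfolding ricci_identity[OF assms] R_target[OF assms(1)] defect_def isometry[OF assms(1)]
  by (simp add: linear_diff[OF linear_Df[OF assms(1)]] linear_cmul[OF linear_Df[OF assms(1)]])

lemma bilinear_defect: "x \<in> S \<Longrightarrow> bilinear (\<lambda>v w. D f x (defect x u v w))"
proof -
  assume x: "x \<in> S"
  have 2: "M.R x u v w = - M.R x v u w" for v w by (rule M.R_antisym)
  show ?thesis
    unfolding bilinear_def defect_def 2
    by (auto intro!: linearI simp: linear_add[OF linear_Df[OF x]] linear_diff[OF linear_Df[OF x]]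
        linear_cmul[OF linear_Df[OF x]] M.H_ladd[OF x] M.H_radd[OF x] M.H_lmul[OF x] M.H_rmul[OF x]
        linear_add[OF M.R_linear1[OF x]] linear_add[OF M.R_linear3[OF x]]
        linear_cmul[OF M.R_linear1[OF x]] linear_cmul[OF M.R_linear3[OF x]] algebra_simps)
qed

lemma trace_defect:
  assumes x: "x \<in> S"
  shows "(\<Sum>j\<in>UNIV. defect x (Y x) (e j x) (e j x)) = defect_trace Y x"
proof -
  have "(\<Sum>j\<in>UNIV. defect x (Y x) (e j x) (e j x))
      = \<kappa> *\<^sub>R (real CARD('m) *\<^sub>R Y x - (\<Sum>j\<in>UNIV. G x (Y x) (e j x) *\<^sub>R e j x)) - ricci_op G e Y x"
    by (simp add: defect_def ricci_op_def sum_subtractf e_orthonormal[OF x] sum_constant_scaleR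
        del: sum_constant flip: scaleR_sum_right)
  then show ?thesis by (simp add: frame_expansion[OF x] defect_trace_def algebra_simps)
qed

lemma trace_nabla2_d_skew_part:
  assumes x: "x \<in> S" and Y: "smooth_on S Y"
  shows "(\<Sum>j\<in>UNIV. nabla2_d G H f Y (e j) (e j) x - nabla2_d G H f (e j) Y (e j) x) = dmap f (defect_trace Y) x"
  by (simp add: nabla2_d_skew_part[OF x Y smooth_e smooth_e] linear_sum[OF linear_Df[OF x], symmetric]
      trace_defect[OF x] dmap_def)

lemma smooth_ricci_op: "smooth_on S Y \<Longrightarrow> smooth_on S (ricci_op G e Y)"
  unfolding ricci_op_def by (intro smooth_on_sum[OF open_S] M.smooth_R smooth_e)

lemma smooth_defect_trace: "smooth_on S Y \<Longrightarrow> smooth_on S (defect_trace Y)"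
  unfolding defect_trace_def
  by (intro smooth_on_diff[OF open_S] smooth_on_scaleR[OF open_S] smooth_on_const smooth_ricci_op)

lemma nabla_defect_trace:
  assumes x: "x \<in> S" and Y: "smooth_on S Y"
  shows "levi_civita G X (defect_trace Y) x - defect_trace (levi_civita G X Y) x = - nabla_ricci G e X Y x"
proof -
  let ?c = "\<kappa> * (real CARD('m) - 1)"
  have "D (\<lambda>y. ?c *\<^sub>R Y y - ricci_op G e Y y) x = (\<lambda>v. ?c *\<^sub>R D Y x v - D (ricci_op G e Y) x v)"
    by (intro D_eqI has_derivative_diff has_derivative_scaleR_right has_D diff_S[OF _ x] Y smooth_ricci_op)
  then show ?thesis
    by (simp add: levi_civita_def nabla_ricci_def defect_trace_def[abs_def] M.\<Gamma>_radd M.\<Gamma>_rsub M.\<Gamma>_rmul algebra_simps)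
qed

text \<open>Both third derivatives differentiate \<open>\<nabla>\<^sup>2d\<phi>\<close> along \<open>e\<^sub>i\<close>, so their difference is the covariant
  derivative of its skew part. Traced over \<open>j\<close>, that part is \<open>d\<phi> \<circ> defect_trace\<close>, and the
  product rule for this composition yields the second fundamental form from \<open>d\<phi>\<close> and \<open>\<nabla>Q\<close> from
  the endomorphism.\<close>

lemma trace_nabla3_d_difference:
  assumes x: "x \<in> S"
  shows "(\<Sum>j\<in>UNIV. nabla3_d G H f (e i) (e i) (e j) (e j) x - nabla3_d G H f (e i) (e j) (e i) (e j) x)
    = (\<kappa> * (real CARD('m) - 1)) *\<^sub>R nabla_d G H f (e i) (e i) x
      - nabla_d G H f (ricci_op G e (e i)) (e i) x - D f x (nabla_ricci G e (e i) (e i) x)"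
proof -
  let ?L = "levi_civita G (e i)" and ?n2 = "nabla2_d G H f"
  have sL: "smooth_on S (?L (e j))" for j by (rule M.smooth_levi_civita[OF smooth_e smooth_e])
  \<comment> \<open>The covariant derivative along \<open>e\<^sub>i\<close> is taken outside the sum over \<open>j\<close>.\<close>
  have leibniz: "(\<Sum>j\<in>UNIV. pb (e i) (?n2 (e i) (e j) (e j)) x - pb (e i) (?n2 (e j) (e i) (e j)) x)
      = pb (e i) (dmap f (defect_trace (e i))) x"
  proof -
    have "(\<Sum>j\<in>UNIV. pb (e i) (?n2 (e i) (e j) (e j)) x - pb (e i) (?n2 (e j) (e i) (e j)) x)
        = (\<Sum>j\<in>UNIV. pb (e i) (\<lambda>y. ?n2 (e i) (e j) (e j) y - ?n2 (e j) (e i) (e j) y) x)"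
      by (simp add: pb_diff[OF x smooth_nabla2_d[OF smooth_e smooth_e smooth_e] smooth_nabla2_d[OF smooth_e smooth_e smooth_e]])
    also have "\<dots> = pb (e i) (\<lambda>y. \<Sum>j\<in>UNIV. ?n2 (e i) (e j) (e j) y - ?n2 (e j) (e i) (e j) y) x"
      by (rule pb_sum[OF x, symmetric])
        (rule smooth_on_diff[OF open_S smooth_nabla2_d[OF smooth_e smooth_e smooth_e] smooth_nabla2_d[OF smooth_e smooth_e smooth_e]])
    also have "\<dots> = pb (e i) (dmap f (defect_trace (e i))) x"
      by (rule pb_cong[OF x]) (rule trace_nabla2_d_skew_part[OF _ smooth_e])
    finally show ?thesis .
  qed
  \<comment> \<open>The terms in which a frame vector is differentiated cancel in the trace.\<close>
  have frame_terms: "(\<Sum>j\<in>UNIV. (?n2 (e i) (?L (e j)) (e j) x - ?n2 (?L (e j)) (e i) (e j) x)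
      + (?n2 (e i) (e j) (?L (e j)) x - ?n2 (e j) (e i) (?L (e j)) x)) = 0"
    unfolding nabla2_d_skew_part[OF x smooth_e sL smooth_e] nabla2_d_skew_part[OF x smooth_e smooth_e sL]
    by (rule skew_frame_sum[OF x frame_derivative_skew[OF x] bilinear_defect[OF x]])
  have "(\<Sum>j\<in>UNIV. nabla3_d G H f (e i) (e i) (e j) (e j) x - nabla3_d G H f (e i) (e j) (e i) (e j) x)
    = (\<Sum>j\<in>UNIV. pb (e i) (?n2 (e i) (e j) (e j)) x - pb (e i) (?n2 (e j) (e i) (e j)) x)
      - (\<Sum>j\<in>UNIV. ?n2 (?L (e i)) (e j) (e j) x - ?n2 (e j) (?L (e i)) (e j) x)
      - (\<Sum>j\<in>UNIV. (?n2 (e i) (?L (e j)) (e j) x - ?n2 (?L (e j)) (e i) (e j) x)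
        + (?n2 (e i) (e j) (?L (e j)) x - ?n2 (e j) (e i) (?L (e j)) x))"
    unfolding sum_subtractf[symmetric]
    by (rule sum.cong[OF refl]) (simp add: nabla3_d_def algebra_simps)
  also have "\<dots> = pb (e i) (dmap f (defect_trace (e i))) x - dmap f (defect_trace (?L (e i))) x"
    by (simp only: leibniz frame_terms trace_nabla2_d_skew_part[OF x sL] diff_zero)
  also have "\<dots> = nabla_d G H f (e i) (defect_trace (e i)) x + D f x (?L (defect_trace (e i)) x - defect_trace (?L (e i)) x)"
    by (simp add: nabla_d_def dmap_def linear_diff[OF linear_Df[OF x]])
  also have "D f x (?L (defect_trace (e i)) x - defect_trace (?L (e i)) x) = - D f x (nabla_ricci G e (e i) (e i) x)"
    by (simp add: nabla_defect_trace[OF x smooth_e] linear_neg[OF linear_Df[OF x]])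
  also have "nabla_d G H f (e i) (defect_trace (e i)) x = II x (defect_trace (e i) x) (e i x)"
    by (simp add: nabla_d_II[OF x smooth_defect_trace[OF smooth_e]] II_sym[OF x, of "e i x"])
  also have "\<dots> = (\<kappa> * (real CARD('m) - 1)) *\<^sub>R nabla_d G H f (e i) (e i) x - nabla_d G H f (ricci_op G e (e i)) (e i) x"
    by (simp add: nabla_d_II[OF x smooth_e] defect_trace_def linear_diff[OF linear_II[OF x]] linear_cmul[OF linear_II[OF x]])
  finally show ?thesis by simp
qed

text \<open>On a normal vector and two tangential ones, the curvature tensor of a space form reduces to
  \<open>\<kappa>\<close> times the normal vector times the inner product of the other two.\<close>

lemma curvature_terms:
  assumes x: "x \<in> S"
  shows "(\<Sum>i\<in>UNIV. \<Sum>j\<in>UNIV. R (f x) (nabla_d G H f (e i) (e i) x) (dmap f (e j) x) (dmap f (e j) x))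
      = (\<kappa> * real CARD('m)) *\<^sub>R (\<Sum>i\<in>UNIV. nabla_d G H f (e i) (e i) x)"
    and "(\<Sum>i\<in>UNIV. \<Sum>j\<in>UNIV. R (f x) (nabla_d G H f (e i) (e j) x) (dmap f (e i) x) (dmap f (e j) x))
      = \<kappa> *\<^sub>R (\<Sum>i\<in>UNIV. nabla_d G H f (e i) (e i) x)"
proof -
  have *: "R (f x) (nabla_d G H f (e i) (e j) x) (dmap f (e k) x) (dmap f (e l) x)
      = (if k = l then \<kappa> *\<^sub>R nabla_d G H f (e i) (e j) x else 0)" for i j k l
    by (simp add: R_target[OF x] nabla_d_II[OF x smooth_e] dmap_def II_normal[OF x] isometry[OF x] e_orthonormal[OF x])
  show "(\<Sum>i\<in>UNIV. \<Sum>j\<in>UNIV. R (f x) (nabla_d G H f (e i) (e i) x) (dmap f (e j) x) (dmap f (e j) x))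
      = (\<kappa> * real CARD('m)) *\<^sub>R (\<Sum>i\<in>UNIV. nabla_d G H f (e i) (e i) x)"
    unfolding * by (simp add: sum_constant_scaleR scaleR_sum_right mult.commute del: sum_constant)
  show "(\<Sum>i\<in>UNIV. \<Sum>j\<in>UNIV. R (f x) (nabla_d G H f (e i) (e j) x) (dmap f (e i) x) (dmap f (e j) x))
      = \<kappa> *\<^sub>R (\<Sum>i\<in>UNIV. nabla_d G H f (e i) (e i) x)"
    unfolding * by (simp add: scaleR_sum_right)
qed

lemma tr_nabla_d: "(\<Sum>i\<in>UNIV. nabla_d G H f (e i) (e i) x) = real CARD('m) *\<^sub>R mean_curvature G H f e x"
  by (simp add: mean_curvature_def)

proposition CF_eq:
  assumes x: "x \<in> S"
  shows "CF G H f e x = - dmap f (tr_nabla_ricci G e) x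
    + (2 * \<kappa> * real CARD('m) * (real CARD('m) - 1)) *\<^sub>R mean_curvature G H f e x - tr_h_ricci G H f e x"
proof -
  let ?t = "\<Sum>i\<in>UNIV. nabla_d G H f (e i) (e i) x" and ?m = "real CARD('m)"
  have "CF G H f e x
    = (\<Sum>i\<in>UNIV. \<Sum>j\<in>UNIV. nabla3_d G H f (e i) (e i) (e j) (e j) x - nabla3_d G H f (e i) (e j) (e i) (e j) x)
      + ((\<Sum>i\<in>UNIV. \<Sum>j\<in>UNIV. R (f x) (nabla_d G H f (e i) (e i) x) (dmap f (e j) x) (dmap f (e j) x))
        - (\<Sum>i\<in>UNIV. \<Sum>j\<in>UNIV. R (f x) (nabla_d G H f (e i) (e j) x) (dmap f (e i) x) (dmap f (e j) x)))"
    by (simp add: CF_def W1_def W2_def sum.distrib sum_subtractf)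
  also have "\<dots> = (\<kappa> * (?m - 1)) *\<^sub>R ?t - tr_h_ricci G H f e x - D f x (tr_nabla_ricci G e x)
      + ((\<kappa> * ?m) *\<^sub>R ?t - \<kappa> *\<^sub>R ?t)"
    unfolding trace_nabla3_d_difference[OF x] curvature_terms[OF x]
    by (simp only: sum_subtractf tr_h_ricci_def tr_nabla_ricci_def linear_sum[OF linear_Df[OF x]] scaleR_sum_right)
  also have "(\<kappa> * ?m) *\<^sub>R ?t - \<kappa> *\<^sub>R ?t = (\<kappa> * (?m - 1)) *\<^sub>R ?t"
    by (simp add: algebra_simps)
  finally show ?thesis by (simp add: tr_nabla_d dmap_def algebra_simps flip: scaleR_add_left)
qed

lemma normal_terms:
  assumes x: "x \<in> S"
  shows "H (f x) (c *\<^sub>R mean_curvature G H f e x - tr_h_ricci G H f e x) (D f x w) = 0"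
  using f_in[OF x]
  by (simp add: mean_curvature_def tr_h_ricci_def H_lsub H_lmul linear_sum[OF linear_H(2)]
      nabla_d_II[OF x smooth_e] II_normal[OF x])

text \<open>The term with \<open>\<nabla>Q\<close> lies in the image of the differential, the others are values of the second
  fundamental form.\<close>

proposition CF_parts:
  assumes x: "x \<in> S"
  shows "tangent_part H f x (CF G H f e x) = - dmap f (tr_nabla_ricci G e) x"
    and "normal_part H f x (CF G H f e x)
      = (2 * \<kappa> * real CARD('m) * (real CARD('m) - 1)) *\<^sub>R mean_curvature G H f e x - tr_h_ricci G H f e x"
proof -
  let ?n = "(2 * \<kappa> * real CARD('m) * (real CARD('m) - 1)) *\<^sub>R mean_curvature G H f e x - tr_h_ricci G H f e x"
  have "CF G H f e x = D f x (- tr_nabla_ricci G e x) + ?n"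
    by (simp add: CF_eq[OF x] dmap_def linear_neg[OF linear_Df[OF x]])
  then have "tangent_part H f x (CF G H f e x) = D f x (- tr_nabla_ricci G e x)"
    by (simp only: tangent_part_eq[OF x normal_terms[OF x]])
  also have "\<dots> = - dmap f (tr_nabla_ricci G e) x"
    by (simp add: dmap_def linear_neg[OF linear_Df[OF x]])
  finally show "tangent_part H f x (CF G H f e x) = - dmap f (tr_nabla_ricci G e) x" .
  then show "normal_part H f x (CF G H f e x) = ?n"
    by (simp add: normal_part_def CF_eq[OF x])
qed

end

section \<open>From charts to manifolds\<close>

lemma chart_inv_left:
  assumes "smooth_atlas A" "c \<in> A" "p \<in> fst c"
  shows "chart_inv c (snd c p) = p"
  using assms by (auto simp: smooth_atlas_def homeomorphism_def)

lemma open_chart_preimage: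
  assumes "smooth_atlas A" "smooth_atlas B" "smooth_map A B \<phi>" "c \<in> A" "d \<in> B"
  shows "open (snd c ` (fst c \<inter> \<phi> -` fst d))"
proof -
  have c: "open (fst c)" "open (chart_image c)" "homeomorphism (fst c) (chart_image c) (snd c) (chart_inv c)"
    using assms(1,4) by (auto simp: smooth_atlas_def)
  have "continuous_on (fst c) \<phi>"
    using assms(3,4) by (auto simp: smooth_map_def manifold_carrier_def intro: continuous_on_subset)
  moreover have "open (fst d)" using assms(2,5) by (auto simp: smooth_atlas_def)
  ultimately have "open (fst c \<inter> \<phi> -` fst d)"
    using c(1) continuous_on_open_vimage[of "fst c" \<phi>] by (metis Int_commute)
  then have "openin (top_of_set (fst c)) (fst c \<inter> \<phi> -` fst d)"
    using c(1) by (simp add: openin_open_eq)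
  then have "openin (top_of_set (chart_image c)) (snd c ` (fst c \<inter> \<phi> -` fst d))"
    using homeomorphism_imp_open_map[OF c(3)] by blast
  then show ?thesis using c(2) by (simp add: openin_open_eq)
qed

text \<open>The domain of the frame serves as the coordinate domain of the source, so that the frame, the
  metric and the map are smooth on one and the same open set.\<close>

lemma framed_isometric_map_in_charts:
  assumes M: "riemannian_manifold AM gM" and N: "riemannian_manifold AN gN"
    and \<kappa>: "constant_sectional_curvature AN gN \<kappa>" and \<phi>: "isometric_immersion AM gM AN gN \<phi>"
    and frame: "local_frame_along AM gM AN \<phi> c d V e"
  shows "framed_isometric_map (chart_image d) (gN d) V (gM c) (coord_rep c d \<phi>) e \<kappa>"
proof -
  have c: "c \<in> AM" and d: "d \<in> AN" and V: "open V" "V \<subseteq> chart_image c" "V \<subseteq> snd c ` (fst c \<inter> \<phi> -` fst d)"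
    and e: "orthonormal_frame_on V (gM c) e"
    using frame by (auto simp: local_frame_along_def local_frame_def)
  have AM: "smooth_atlas AM" using M by (simp add: riemannian_manifold_def)
  have gM: "local_riemannian_metric V (gM c)"
  proof -
    have "local_riemannian_metric (chart_image c) (gM c)"
      using M c by (simp add: riemannian_manifold_def riemannian_metric_def)
    then show ?thesis using V(2) smooth_on_subset[OF _ V(2)] unfolding local_riemannian_metric_def by blast
  qed
  have point: "\<exists>p. x = snd c p \<and> p \<in> fst c \<inter> \<phi> -` fst d \<and> coord_rep c d \<phi> x = snd d (\<phi> p)" if "x \<in> V" for x
  proof -
    obtain p where "p \<in> fst c \<inter> \<phi> -` fst d" "x = snd c p" using \<open>x \<in> V\<close> V(3) by blast
    then show ?thesis using chart_inv_left[OF AM c, of p] by (auto simp: coord_rep_def)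
  qed
  show ?thesis
  proof unfold_locales
    show "open V" "local_riemannian_metric V (gM c)" by fact+
    show "open (chart_image d)" using N d by (simp add: riemannian_manifold_def smooth_atlas_def)
    show "local_riemannian_metric (chart_image d) (gN d)"
      using N d by (simp add: riemannian_manifold_def riemannian_metric_def)
    show "smooth_on V (coord_rep c d \<phi>)"
    proof (rule smooth_on_subset[OF _ V(3)])
      show "smooth_on (snd c ` (fst c \<inter> \<phi> -` fst d)) (coord_rep c d \<phi>)"
        using \<phi> c d by (simp add: isometric_immersion_def smooth_map_def)
    qed
    show "coord_rep c d \<phi> ` V \<subseteq> chart_image d"
    proof
      fix y assume "y \<in> coord_rep c d \<phi> ` V"
      then obtain x p where "y = coord_rep c d \<phi> x" "p \<in> fst c \<inter> \<phi> -` fst d" "coord_rep c d \<phi> x = snd d (\<phi> p)"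
        using point by blast
      then show "y \<in> chart_image d" by (simp add: chart_image_def)
    qed
    show "gN d (coord_rep c d \<phi> x) (D (coord_rep c d \<phi>) x u) (D (coord_rep c d \<phi>) x v) = gM c x u v"
      if "x \<in> V" for x u v
    proof -
      obtain p where "x = snd c p" "p \<in> fst c \<inter> \<phi> -` fst d" "coord_rep c d \<phi> x = snd d (\<phi> p)"
        using point[OF \<open>x \<in> V\<close>] by blast
      then show ?thesis using \<phi> c d by (simp add: isometric_immersion_def)
    qed
    show "orthonormal_frame_on V (gM c) e" by fact
    show "sectional_curvature (gN d) y u v = \<kappa>"
      if "y \<in> chart_image d" "u \<noteq> v \<and> independent {u, v}" for y u v
      using \<kappa> d that unfolding constant_sectional_curvature_def by blast
  qed
qed

text \<open>The tangential equation involves no chart of the target and is claimed for all frames. Near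
  each point of its domain a frame can be restricted to an open set that is mapped into a single
  chart of the target.\<close>

lemma local_frame_refine:
  assumes M: "riemannian_manifold AM gM" and N: "riemannian_manifold AN gN"
    and \<phi>: "isometric_immersion AM gM AN gN \<phi>"
    and frame: "local_frame AM gM c V e" and x: "x \<in> V"
  obtains d W where "x \<in> W" "local_frame_along AM gM AN \<phi> c d W e"
proof -
  have c: "c \<in> AM" and V: "open V" "V \<subseteq> chart_image c" and e: "orthonormal_frame_on V (gM c) e"
    using frame by (auto simp: local_frame_def)
  obtain p where p: "p \<in> fst c" "x = snd c p" using x V(2) by (auto simp: chart_image_def)
  have "\<phi> ` manifold_carrier AM \<subseteq> manifold_carrier AN"
    using \<phi> by (simp add: isometric_immersion_def smooth_map_def)
  moreover have "p \<in> manifold_carrier AM" using c p by (auto simp: manifold_carrier_def)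
  ultimately have "\<phi> p \<in> manifold_carrier AN" by blast
  then obtain d where d: "d \<in> AN" "\<phi> p \<in> fst d" by (auto simp: manifold_carrier_def)
  let ?W = "V \<inter> snd c ` (fst c \<inter> \<phi> -` fst d)"
  have "open ?W"
    using open_chart_preimage[of AM AN \<phi> c d] M N \<phi> c d(1) V(1)
    unfolding riemannian_manifold_def isometric_immersion_def by blast
  moreover have "orthonormal_frame_on ?W (gM c) e"
    using e smooth_on_subset[of V _ ?W] by (auto simp: orthonormal_frame_on_def)
  ultimately have along: "local_frame_along AM gM AN \<phi> c d ?W e"
    using c d(1) V(2) unfolding local_frame_along_def local_frame_def by blast
  have "x \<in> ?W" using x p d(2) by blast
  from this along show ?thesis by (rule that)
qed

theorem theorem5p1:
  fixes AM :: "('a::{t2_space,second_countable_topology}, 'm::finite) chart set"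
    and gM :: "('a, 'm) chart \<Rightarrow> 'm local_metric"
    and AN :: "('b::{t2_space,second_countable_topology}, 'n::finite) chart set"
    and gN :: "('b, 'n) chart \<Rightarrow> 'n local_metric"
    and \<phi> :: "'a \<Rightarrow> 'b"
    and \<kappa> :: real
  assumes "riemannian_manifold AM gM"
    and "riemannian_manifold AN gN"
    and "constant_sectional_curvature AN gN \<kappa>"
    and "isometric_immersion AM gM AN gN \<phi>"
  shows
    "(\<forall>c d V e. local_frame_along AM gM AN \<phi> c d V e \<longrightarrow>
       (let G = gM c; H = gN d; f = coord_rep c d \<phi>; m = real CARD('m) in \<forall>x\<in>V.
          CF G H f e x =
            - dmap f (tr_nabla_ricci G e) x
            + (2 * \<kappa> * m * (m - 1)) *\<^sub>R mean_curvature G H f e x - tr_h_ricci G H f e x \<and>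
          tangent_part H f x (CF G H f e x) = - dmap f (tr_nabla_ricci G e) x \<and>
          normal_part H f x (CF G H f e x) =
            (2 * \<kappa> * m * (m - 1)) *\<^sub>R mean_curvature G H f e x - tr_h_ricci G H f e x)) \<and>
     (chern_federer_map AM gM AN gN \<phi> \<longleftrightarrow>
       (\<forall>c d V e. local_frame_along AM gM AN \<phi> c d V e \<longrightarrow>
          (let G = gM c; H = gN d; f = coord_rep c d \<phi>; m = real CARD('m) in \<forall>x\<in>V.
             - dmap f (tr_nabla_ricci G e) x
             + (2 * \<kappa> * m * (m - 1)) *\<^sub>R mean_curvature G H f e x - tr_h_ricci G H f e x = 0))) \<and>
     (chern_federer_map AM gM AN gN \<phi> \<longleftrightarrow>
       (\<forall>c V e. local_frame AM gM c V e \<longrightarrow> (\<forall>x\<in>V. tr_nabla_ricci (gM c) e x = 0)) \<and>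
       (\<forall>c d V e. local_frame_along AM gM AN \<phi> c d V e \<longrightarrow>
          (let G = gM c; H = gN d; f = coord_rep c d \<phi>; m = real CARD('m) in \<forall>x\<in>V.
             (2 * \<kappa> * m * (m - 1)) *\<^sub>R mean_curvature G H f e x - tr_h_ricci G H f e x = 0)))"
proof -
  define m where "m = real CARD('m)"
  define CFx where "CFx c d e x = CF (gM c) (gN d) (coord_rep c d \<phi>) e x" for c d e x
  define tangential where "tangential c d e x = - dmap (coord_rep c d \<phi>) (tr_nabla_ricci (gM c) e) x"
    for c and d :: "('b, 'n) chart" and e x
  define normal where "normal c d e x = (2 * \<kappa> * m * (m - 1)) *\<^sub>R mean_curvature (gM c) (gN d) (coord_rep c d \<phi>) e x
      - tr_h_ricci (gM c) (gN d) (coord_rep c d \<phi>) e x" for c d e x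
  note defs = m_def CFx_def tangential_def normal_def
  let ?along = "local_frame_along AM gM AN \<phi>"
  note local = framed_isometric_map_in_charts[OF assms]
  have formula: "CFx c d e x = tangential c d e x + normal c d e x"
    and tangent_eq: "tangent_part (gN d) (coord_rep c d \<phi>) x (CFx c d e x) = tangential c d e x"
    and normal_eq: "normal_part (gN d) (coord_rep c d \<phi>) x (CFx c d e x) = normal c d e x"
    if "?along c d V e" "x \<in> V" for c d V e x
    using framed_isometric_map.CF_eq[OF local[OF that(1)] that(2)]
      framed_isometric_map.CF_parts[OF local[OF that(1)] that(2)]
    by (simp_all add: defs)
  have tangent_zero: "tangential c d e x = 0 \<longleftrightarrow> tr_nabla_ricci (gM c) e x = 0"
    if "?along c d V e" "x \<in> V" for c d V e x
  proof -
    interpret framed_isometric_map "chart_image d" "gN d" V "gM c" "coord_rep c d \<phi>" e \<kappa>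
      by (rule local[OF that(1)])
    show ?thesis using Df_injective[OF that(2)] linear_0[OF linear_Df[OF that(2)]]
      by (auto simp: tangential_def dmap_def)
  qed
  have CF_zero: "CFx c d e x = 0 \<longleftrightarrow> tr_nabla_ricci (gM c) e x = 0 \<and> normal c d e x = 0"
    if a: "?along c d V e" "x \<in> V" for c d V e x
  proof -
    have "tangential c d e x = 0 \<and> normal c d e x = 0" if "CFx c d e x = 0"
    proof -
      interpret framed_isometric_map "chart_image d" "gN d" V "gM c" "coord_rep c d \<phi>" e \<kappa>
        by (rule local[OF a(1)])
      have "tangent_part (gN d) (coord_rep c d \<phi>) x 0 = 0"
        using tangent_part_eq[OF a(2), of 0 0] linear_0[OF linear_Df[OF a(2)]] H_lzero[OF f_in[OF a(2)]] by simp
      then show ?thesis using tangent_eq[OF a] formula[OF a] that by simp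
    qed
    then show ?thesis using formula[OF a] tangent_zero[OF a] by auto
  qed
  have cf: "chern_federer_map AM gM AN gN \<phi> \<longleftrightarrow> (\<forall>c d V e. ?along c d V e \<longrightarrow> (\<forall>x\<in>V. CFx c d e x = 0))"
    by (simp add: chern_federer_map_def CFx_def)
  have split: "chern_federer_map AM gM AN gN \<phi> \<longleftrightarrow>
      (\<forall>c V e. local_frame AM gM c V e \<longrightarrow> (\<forall>x\<in>V. tr_nabla_ricci (gM c) e x = 0)) \<and>
      (\<forall>c d V e. ?along c d V e \<longrightarrow> (\<forall>x\<in>V. normal c d e x = 0))"
  proof (intro iffI conjI allI impI ballI)
    fix c V e x assume CF: "chern_federer_map AM gM AN gN \<phi>" and "local_frame AM gM c V e" "x \<in> V"
    then obtain d W where W: "x \<in> W" "?along c d W e" using local_frame_refine[OF assms(1,2,4)] by metis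
    then show "tr_nabla_ricci (gM c) e x = 0" using CF CF_zero[OF W(2,1)] unfolding cf by blast
  next
    fix c d V e x assume "chern_federer_map AM gM AN gN \<phi>" "?along c d V e" "x \<in> V"
    then show "normal c d e x = 0" using CF_zero unfolding cf by blast
  next
    assume h: "(\<forall>c V e. local_frame AM gM c V e \<longrightarrow> (\<forall>x\<in>V. tr_nabla_ricci (gM c) e x = 0)) \<and>
      (\<forall>c d V e. ?along c d V e \<longrightarrow> (\<forall>x\<in>V. normal c d e x = 0))"
    then show "chern_federer_map AM gM AN gN \<phi>"
      unfolding cf using CF_zero by (metis local_frame_along_def)
  qed
  have cf': "chern_federer_map AM gM AN gN \<phi> \<longleftrightarrow>
      (\<forall>c d V e. ?along c d V e \<longrightarrow> (\<forall>x\<in>V. tangential c d e x + normal c d e x = 0))"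
    unfolding cf using formula by metis
  have parts: "\<forall>c d V e. ?along c d V e \<longrightarrow> (\<forall>x\<in>V. CFx c d e x = tangential c d e x + normal c d e x \<and>
      tangent_part (gN d) (coord_rep c d \<phi>) x (CFx c d e x) = tangential c d e x \<and>
      normal_part (gN d) (coord_rep c d \<phi>) x (CFx c d e x) = normal c d e x)"
    using formula tangent_eq normal_eq by blast
  show ?thesis
    using parts cf' split unfolding Let_def defs add_diff_eq by blast
qed

end
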